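(* Let $\Bbbk$ be an arbitrary field, let $X=(x_{i,j})$ be a $k\times\ell$ matrix of distinct indeterminates with $k\le\ell$, and let $R=\Bbbk[X]$. Let $f=f(X)$ be the polynomial $$f(X)=\prod_{j=0}^{k-2}\left[\det\left(X_{[1,j+1]}^{[1,j+1]}\right)\det\left(X_{[\ell-j,\ell]}^{[k-j,k]}\right)\right]\prod_{j=1}^{\ell-k+1}\det\left(X_{[j,k+j-1]}\right).$$ Then for every $1\le r\le k$, $1\le s\le\ell$ and every positive integer $t\le\min\{r,s\}$, we have $I_t(X_{r\times s})\in\mathcal{C}_f$ and $I_t(X^{r\times s})\in\mathcal{C}_f$.
   Context: $X_{[a,b]}^{[c,d]}$ is the submatrix of $X$ with column indices $a,\ldots,b$ and row indices $c,\ldots,d$; $X_{[a,b]}=X_{[a,b]}^{[1,k]}$. $X_{r\times s}=X_{[1,s]}^{[1,r]}$ is the northwest $r\times s$ submatrix and $X^{r\times s}=X_{[\ell-s+1,\ell]}^{[k-r+1,k]}$ is the southeast $r\times s$ submatrix. For a submatrix $Y$ of $X$, $I_t(Y)$ is the ideal of $R$ generated by the $t$-minors of $Y$. Knutson ideals: for $f\in R$ a homogeneous polynomial whose leading term with respect to some term order is a squarefree monomial (the $f(X)$ above has this property for antidiagonal term orders), $\mathcal{C}_f$ is the smallest set of ideals of $R$ such that: (i) $(f)\in\mathcal{C}_f$; (ii) if $I\in\mathcal{C}_f$ then $(I:J)\in\mathcal{C}_f$ for every ideal $J\subseteq R$; (iii) if $I,J\in\mathcal{C}_f$ then $I+J\in\mathcal{C}_f$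 and $I\cap J\in\mathcal{C}_f$. *)

theory Defs
  imports
    "HOL-Library.Poly_Mapping"
    "HOL-Algebra.Ideal"
    "Jordan_Normal_Form.Determinant"
    "Jordan_Normal_Form.DL_Submatrix"
begin

text \<open>A multivariate polynomial with coefficients in \<open>'a\<close> and indeterminates in \<open>'x\<close>: a finitely
  supported map from monomials (finitely supported exponent vectors) to coefficients. Its product is
  the convolution product of \<open>HOL-Library.Poly_Mapping\<close>.\<close>

type_synonym ('x, 'a) mpoly = "('x \<Rightarrow>\<^sub>0 nat) \<Rightarrow>\<^sub>0 'a"

definition indet :: "'x \<Rightarrow> ('x, 'a::comm_ring_1) mpoly" where
  "indet x = Poly_Mapping.single (Poly_Mapping.single x 1) 1"

text \<open>The ring of polynomials in the indeterminates \<open>V\<close> only. An explicit carrier is needed because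
  the type itself contains polynomials in all indeterminates of type \<open>'x\<close>.\<close>

definition polynomial_ring :: "'x set \<Rightarrow> ('x, 'a::comm_ring_1) mpoly ring" where
  "polynomial_ring V =
    \<lparr>carrier = {p. \<forall>m \<in> Poly_Mapping.keys p. Poly_Mapping.keys m \<subseteq> V},
     monoid.mult = (*), one = 1, zero = 0, add = (+)\<rparr>"

text \<open>Matrix entries are indexed from 0, so the indeterminate written \<open>x\<^bsub>i,j\<^esub>\<close> with 1-based indices
  is \<open>indet (i - 1, j - 1)\<close>.\<close>

definition generic_matrix :: "nat \<Rightarrow> nat \<Rightarrow> (nat \<times> nat, 'a::comm_ring_1) mpoly mat" where
  "generic_matrix k l = mat k l (\<lambda>(i, j). indet (i, j))"

definition generic_ring :: "nat \<Rightarrow> nat \<Rightarrow> (nat \<times> nat, 'a::comm_ring_1) mpoly ring" where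
  "generic_ring k l = polynomial_ring ({..<k} \<times> {..<l})"

text \<open>The submatrix \<open>X\<^bsub>[a,b]\<^esub>\<^bsup>[c,d]\<^esup>\<close> with columns \<open>a, \<dots>, b\<close> and rows \<open>c, \<dots>, d\<close>, where the four
  bounds are 1-based and inclusive.\<close>

definition block :: "'b mat \<Rightarrow> nat \<Rightarrow> nat \<Rightarrow> nat \<Rightarrow> nat \<Rightarrow> 'b mat" where
  "block X a b c d = submatrix X {c - 1..<d} {a - 1..<b}"

definition northwest :: "'b mat \<Rightarrow> nat \<Rightarrow> nat \<Rightarrow> 'b mat" where
  "northwest X r s = block X 1 s 1 r"

definition southeast :: "'b mat \<Rightarrow> nat \<Rightarrow> nat \<Rightarrow> 'b mat" where
  "southeast X r s =
    block X (dim_col X - s + 1) (dim_col X) (dim_row X - r + 1) (dim_row X)"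

definition minors :: "nat \<Rightarrow> 'b::comm_ring_1 mat \<Rightarrow> 'b set" where
  "minors t Y = {det (submatrix Y I J) | I J.
     I \<subseteq> {..<dim_row Y} \<and> J \<subseteq> {..<dim_col Y} \<and> card I = t \<and> card J = t}"

definition minor_ideal :: "('b::comm_ring_1, 'm) ring_scheme \<Rightarrow> nat \<Rightarrow> 'b mat \<Rightarrow> 'b set" where
  "minor_ideal R t Y = Idl\<^bsub>R\<^esub> (minors t Y)"

definition ideal_quotient :: "('b, 'm) ring_scheme \<Rightarrow> 'b set \<Rightarrow> 'b set \<Rightarrow> 'b set" where
  "ideal_quotient R I J = {r \<in> carrier R. \<forall>x \<in> J. r \<otimes>\<^bsub>R\<^esub> x \<in> I}"

text \<open>The Knutson ideals associated to \<open>f\<close>. The construction makes sense for every \<open>f\<close>; it is of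
  interest when \<open>f\<close> is homogeneous with squarefree leading monomial for some term order.\<close>

inductive_set knutson_ideals :: "('b, 'm) ring_scheme \<Rightarrow> 'b \<Rightarrow> 'b set set"
  for R :: "('b, 'm) ring_scheme" and f :: 'b where
  principal: "PIdl\<^bsub>R\<^esub> f \<in> knutson_ideals R f"
| quotient: "I \<in> knutson_ideals R f \<Longrightarrow> ideal J R \<Longrightarrow> ideal_quotient R I J \<in> knutson_ideals R f"
| sum: "I \<in> knutson_ideals R f \<Longrightarrow> J \<in> knutson_ideals R f \<Longrightarrow> I <+>\<^bsub>R\<^esub> J \<in> knutson_ideals R f"
| inter: "I \<in> knutson_ideals R f \<Longrightarrow> J \<in> knutson_ideals R f \<Longrightarrow> I \<inter> J \<in> knutson_ideals R f"

text \<open>The range \<open>0 \<le> j \<le> k - 2\<close> of the first product is written \<open>j < k - 1\<close>, so that it is empty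
  for \<open>k = 1\<close> despite truncated subtraction.\<close>

definition knutson_poly :: "nat \<Rightarrow> nat \<Rightarrow> 'b::comm_ring_1 mat \<Rightarrow> 'b" where
  "knutson_poly k l X =
    (\<Prod>j<k - 1. det (block X 1 (j + 1) 1 (j + 1)) * det (block X (l - j) l (k - j) k)) *
    (\<Prod>j = 1..l - k + 1. det (block X j (k + j - 1) 1 k))"

end

(* A determinantal ideal I_t is recovered as a colon ideal (S : g), where S is a sum of smaller Knutson
   ideals contained in I_t, g I_t <= S, and g is a nonzerodivisor modulo I_t. Let D be a (t-1)-minor.
   Modulo the t-minors bordering D, the matrix multiplied by D has rank t-1, so a power of D multiplies
   every t-minor into the ideal of the bordering minors. Hence, for a rectangle of size r x s:
   - if t < s and r < k, take S = I_t(r x (s-1)) + I_t((r-1) x s) + I_(t+1)((r+1) x s). Only the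
     bordering minor at the corner (r,s) is missing from S, and its product with the bordering minor of
     a new row r+1 and an old column lies in S. The case t < r, s < l is the transpose;
   - for t = k on adjacent columns, and for the whole matrix with t < k, take for S the sum of the two
     ideals obtained by deleting the first or the last column;
   - the square rectangles are the principal ideals of the factors of f.
   The induction is on (r-t) + (s-t), simultaneously for northwest and southeast rectangles.

   The nonzerodivisor property follows from primality of I_t. Here boxes are added one at a time to the
   last column of a partial rectangle carrying rank conditions on its initial row blocks. A new
   indeterminate y enters the new generators as q_i y + d_i, and these all vanish at y = r/q modulo
   the prime ideal N of the old generators; N + (q_i) is the ideal C of a smaller such family, hence
   prime by induction, and r is not in C. This makes the new ideal the kernel of the evaluation at
   y = r/q. *)

theory Submission
  imports Defs "HOL-Library.Product_Lexorder" "HOL-Computational_Algebra.Polynomial"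
begin

subsection \<open>Ideals of a commutative ring as submodules\<close>

text \<open>Adding the coefficients \<open>q_i\<close> to the old ideal lowers the rank allowed in
  the upper rows only, so ideals of minors of one fixed size on partial rectangles are not closed
  under the passage from \<open>N\<close> to \<open>C\<close>. Rank bounds that vary with the height
  of the row block repair this: \<open>C\<close> caps the bound on the upper rows and keeps it below
  them, and primality is proved for all such profiles together.

  Fraction fields and quotient rings are replaced by the homogenised evaluation \<open>hev\<close>
  and by congruences modulo spans. Non-membership, of \<open>q\<close> and \<open>r\<close> in the
  extension step as well as of the colon elements, is read off from partial permutation matrices, on
  which a rank condition becomes a count of ones.

  The new row in the first colon construction is forced: the missing corner is cancelled by a
  t-minor that must stay outside I_t, so it needs a row outside the rectangle. The price is the
  summand of (t+1)-minors; for it r - t is unchanged and s - t drops by one, so the induction still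
  descends.\<close>

abbreviation idl :: "'b::comm_ring_1 set \<Rightarrow> 'b set" where
  "idl \<equiv> Modules.module.span (*)"

interpretation idl: Modules.module "(*) :: 'b::comm_ring_1 \<Rightarrow> 'b \<Rightarrow> 'b"
  by unfold_locales (auto simp: algebra_simps)

text \<open>Reassociates in the direction opposite to \<open>mult.assoc\<close>.\<close>

declare idl.scale_scale [simp del]

lemma idl_subsetI: "S \<subseteq> idl T \<Longrightarrow> idl S \<subseteq> idl T"
  by (rule idl.span_minimal) (auto simp: idl.subspace_span)

lemma idl_mult_right: "z \<in> idl S \<Longrightarrow> z * a \<in> idl S"
  using idl.span_scale[of z S a] by (simp add: mult.commute)

text \<open>Stated without properness: the proofs cancel elements, each of which comes with its own
  proof of not lying in the ideal.\<close>

definition prime_like :: "'b::comm_ring_1 set \<Rightarrow> bool" where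
  "prime_like I \<longleftrightarrow> (\<forall>a b. a * b \<in> I \<longrightarrow> a \<in> I \<or> b \<in> I)"

lemma prime_likeD: "prime_like I \<Longrightarrow> a * b \<in> I \<Longrightarrow> a \<in> I \<or> b \<in> I"
  by (auto simp: prime_like_def)

lemma prime_like_power_mult: "prime_like I \<Longrightarrow> a ^ n * b \<in> I \<Longrightarrow> a \<notin> I \<Longrightarrow> b \<in> I"
proof (induction n)
  case (Suc n)
  then show ?case
    using prime_likeD[of I a "a ^ n * b"] by (simp add: mult.assoc)
qed simp

lemma prod_diff_mem_idl:
  assumes "finite A" "\<And>i. i \<in> A \<Longrightarrow> u i - v i \<in> idl S"
  shows "prod u A - prod v A \<in> idl S"
  using assms
proof (induction A rule: finite_induct)
  case (insert x A)
  have "prod u (insert x A) - prod v (insert x A)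
      = prod u A * (u x - v x) + v x * (prod u A - prod v A)"
    using insert by (simp add: algebra_simps)
  also have "\<dots> \<in> idl S"
    by (intro idl.span_add idl.span_scale) (use insert in auto)
  finally show ?case .
qed (simp add: idl.span_zero)

subsection \<open>Minors\<close>

text \<open>Rows and columns are picked by functions, which may repeat or permute indices. Such
  minors are zero or agree up to sign, and replacing the last index is the plain update
  \<open>f(m := a)\<close>.\<close>

definition minor :: "(nat \<Rightarrow> nat \<Rightarrow> 'b::comm_ring_1) \<Rightarrow> nat \<Rightarrow> (nat \<Rightarrow> nat) \<Rightarrow> (nat \<Rightarrow> nat) \<Rightarrow> 'b" where
  "minor M t f g = det (mat t t (\<lambda>(a, b). M (f a) (g b)))"

lemma minor_cong:
  assumes "\<And>a b. a < t \<Longrightarrow> b < t \<Longrightarrow> M (f a) (g b) = M' (f' a) (g' b)"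
  shows "minor M t f g = minor M' t f' g'"
proof -
  have "mat t t (\<lambda>(a, b). M (f a) (g b)) = mat t t (\<lambda>(a, b). M' (f' a) (g' b))"
    by (intro eq_matI) (use assms in auto)
  then show ?thesis by (simp add: minor_def)
qed

lemma minor_0 [simp]: "minor M 0 f g = 1"
  by (simp add: minor_def)

lemma minor_transpose: "minor (\<lambda>i j. M j i) t g f = minor M t f g"
proof -
  have "mat t t (\<lambda>(a, b). M (f b) (g a)) = transpose_mat (mat t t (\<lambda>(a, b). M (f a) (g b)))"
    by (intro eq_matI) auto
  then show ?thesis
    by (simp add: minor_def det_transpose[where n = t])
qed

lemma minor_leibniz:
  "minor M t f g = (\<Sum>p | p permutes {0..<t}. signof p * (\<Prod>i = 0..<t. M (f i) (g (p i))))"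
proof -
  have "minor M t f g = (\<Sum>p | p permutes {0..<t}.
      signof p * (\<Prod>i = 0..<t. mat t t (\<lambda>(a, b). M (f a) (g b)) $$ (i, p i)))"
    unfolding minor_def by (rule det_def'[where n = t]) simp
  also have "\<dots> = (\<Sum>p | p permutes {0..<t}. signof p * (\<Prod>i = 0..<t. M (f i) (g (p i))))"
    by (intro sum.cong prod.cong arg_cong2[where f = "(*)"] refl)
       (auto dest: permutes_in_image)
  finally show ?thesis .
qed

text \<open>Composing an index function with \<open>skip i\<close> deletes its entry at position
  \<open>i\<close>.\<close>

definition skip :: "nat \<Rightarrow> nat \<Rightarrow> nat" where
  "skip i a = (if a < i then a else Suc a)"

lemma minor_laplace_row:
  assumes "i \<le> m"
  shows "minor M (Suc m) f g =
    (\<Sum>j\<le>m. M (f i) (g j) * ((-1) ^ (i + j) * minor M m (f \<circ> skip i) (g \<circ> skip j)))"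
proof -
  let ?A = "mat (Suc m) (Suc m) (\<lambda>(a, b). M (f a) (g b))"
  have "det ?A = (\<Sum>j<Suc m. ?A $$ (i, j) * cofactor ?A i j)"
    by (rule laplace_expansion_row) (use assms in auto)
  also have "\<dots> = (\<Sum>j\<le>m. M (f i) (g j) * ((-1) ^ (i + j) * minor M m (f \<circ> skip i) (g \<circ> skip j)))"
    unfolding lessThan_Suc_atMost
  proof (rule sum.cong)
    fix j assume j: "j \<in> {..m}"
    have "mat_delete ?A i j = mat m m (\<lambda>(a, b). M ((f \<circ> skip i) a) ((g \<circ> skip j) b))"
      unfolding mat_delete_def by (intro eq_matI) (auto simp: skip_def)
    then show "?A $$ (i, j) * cofactor ?A i j =
        M (f i) (g j) * ((-1) ^ (i + j) * minor M m (f \<circ> skip i) (g \<circ> skip j))"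
      using assms j by (simp add: cofactor_def minor_def)
  qed simp
  finally show ?thesis by (simp add: minor_def)
qed

text \<open>Serves both for polynomials free of an indeterminate and for the carrier of a polynomial
  ring; Laplace expansion uses nothing but ring operations.\<close>

lemma minor_closed:
  assumes "\<And>x y. x \<in> S \<Longrightarrow> y \<in> S \<Longrightarrow> x + y \<in> S" "\<And>x y. x \<in> S \<Longrightarrow> y \<in> S \<Longrightarrow> x * y \<in> S"
    and "1 \<in> S" "-1 \<in> S" "0 \<in> S"
    and "\<And>a b. a < t \<Longrightarrow> b < t \<Longrightarrow> M (f a) (g b) \<in> S"
  shows "minor M t f g \<in> S"
  using assms(6)
proof (induction t arbitrary: f g)
  case (Suc t)
  have pow: "(-1) ^ n \<in> S" for n :: nat
  proof (induction n)
    case (Suc n)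
    then show ?case
      unfolding power_Suc by (intro assms)
  qed (use assms in auto)
  have sum: "(\<And>x. x \<in> A \<Longrightarrow> h x \<in> S) \<Longrightarrow> sum h A \<in> S" if "finite A" for h :: "nat \<Rightarrow> 'a" and A
    using that by (induction A rule: finite_induct) (auto intro: assms)
  show ?case
    unfolding minor_laplace_row[OF le0]
    by (intro sum assms(2) pow Suc.IH)
       (auto simp: skip_def intro: Suc.prems)
qed (use assms in auto)

text \<open>Takes the place of reduction to a quotient ring: congruent entries give congruent
  Leibniz terms.\<close>

lemma minor_diff_mem_idl:
  assumes "\<And>a b. a < t \<Longrightarrow> b < t \<Longrightarrow> M (f a) (g b) - M' (f a) (g b) \<in> idl S"
  shows "minor M t f g - minor M' t f g \<in> idl S"
proof -
  have "minor M t f g - minor M' t f g = (\<Sum>p | p permutes {0..<t}.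
      signof p * ((\<Prod>i = 0..<t. M (f i) (g (p i))) - (\<Prod>i = 0..<t. M' (f i) (g (p i)))))"
    by (simp add: minor_leibniz sum_subtractf algebra_simps)
  also have "\<dots> \<in> idl S"
    by (intro idl.span_sum idl.span_scale prod_diff_mem_idl)
       (auto intro!: assms dest: permutes_in_image)
  finally show ?thesis .
qed

lemma minor_smult: "minor (\<lambda>i j. c * M i j) t f g = c ^ t * minor M t f g"
proof -
  have "mat t t (\<lambda>(a, b). c * M (f a) (g b)) = c \<cdot>\<^sub>m mat t t (\<lambda>(a, b). M (f a) (g b))"
    by (intro eq_matI) auto
  then show ?thesis by (simp add: minor_def)
qed

lemma minor_zero_row:
  assumes "i < t" "\<And>b. b < t \<Longrightarrow> M (f i) (g b) = 0"
  shows "minor M t f g = 0"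
proof -
  obtain m where t: "t = Suc m" using assms by (cases t) auto
  show ?thesis
    unfolding t by (subst minor_laplace_row[of i]) (use assms t in auto)
qed

lemma minor_zero_col:
  assumes "i < t" "\<And>b. b < t \<Longrightarrow> M (f b) (g i) = 0"
  shows "minor M t f g = 0"
  using minor_zero_row[of i t "\<lambda>i j. M j i" g f] assms by (simp add: minor_transpose[of M])

lemma minor_not_inj_row:
  assumes "\<not> inj_on f {..<t}"
  shows "minor M t f g = 0"
proof -
  obtain i j where "i < t" "j < t" "i \<noteq> j" "f i = f j"
    using assms by (auto simp: inj_on_def)
  then show ?thesis
    unfolding minor_def by (intro det_identical_rows[where i = i and j = j]) auto
qed

lemma minor_not_inj_col: "\<not> inj_on g {..<t} \<Longrightarrow> minor M t f g = 0"
  using minor_not_inj_row[of g t "\<lambda>i j. M j i" f] by (simp add: minor_transpose[of M])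

lemma minor_permute_row:
  assumes "p permutes {0..<t}"
  shows "minor M t (f \<circ> p) g = signof p * minor M t f g"
proof -
  let ?A = "mat t t (\<lambda>(a, b). M (f a) (g b))"
  have "mat t t (\<lambda>(a, b). M ((f \<circ> p) a) (g b)) = mat t t (\<lambda>(a, b). ?A $$ (p a, b))"
    using permutes_in_image[OF assms] by (intro eq_matI) auto
  then show ?thesis
    using det_permute_rows[OF _ assms, of ?A] by (simp add: minor_def)
qed

lemma minor_permute_col:
  assumes "p permutes {0..<t}"
  shows "minor M t f (g \<circ> p) = signof p * minor M t f g"
  using minor_permute_row[OF assms, of "\<lambda>i j. M j i" g f] by (simp add: minor_transpose[of M])

text \<open>A product through \<open>m\<close> columns has rank at most \<open>m\<close>. A zero
  column appended to the left factor makes both factors square, so the determinant is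
  multiplicative.\<close>

lemma minor_factor_zero: "minor (\<lambda>i j. \<Sum>c<m. U i c * H c j) (Suc m) f g = 0"
proof -
  let ?A = "mat (Suc m) (Suc m) (\<lambda>(a, c). if c < m then U (f a) c else 0)"
  let ?B = "mat (Suc m) (Suc m) (\<lambda>(c, b). H c (g b))"
  have AB: "mat (Suc m) (Suc m) (\<lambda>(a, b). \<Sum>c<m. U (f a) c * H c (g b)) = ?A * ?B"
  proof (intro eq_matI)
    fix a b assume "a < dim_row (?A * ?B)" "b < dim_col (?A * ?B)"
    then have ab: "a < Suc m" "b < Suc m" by simp_all
    have "(?A * ?B) $$ (a, b) = (\<Sum>c = 0..<Suc m. (if c < m then U (f a) c else 0) * H c (g b))"
      using ab by (simp add: scalar_prod_def del: sum.op_ivl_Suc)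
    also have "\<dots> = (\<Sum>c<m. U (f a) c * H c (g b))"
      by (simp add: atLeast0LessThan)
    finally show "mat (Suc m) (Suc m) (\<lambda>(a, b). \<Sum>c<m. U (f a) c * H c (g b)) $$ (a, b) = (?A * ?B) $$ (a, b)"
      using ab by simp
  qed auto
  have "minor (\<lambda>a c. if c < m then U (f a) c else 0) (Suc m) (\<lambda>x. x) (\<lambda>x. x) = 0"
    by (rule minor_zero_col[of m]) auto
  then have A: "det ?A = 0"
    unfolding minor_def .
  have "det (?A * ?B) = det ?A * det ?B"
    by (rule det_mult) auto
  then have "det (?A * ?B) = 0"
    unfolding A by (simp only: mult_zero_left)
  then show ?thesis
    unfolding minor_def AB .
qed

section \<open>Bordered minors and ideals of minors\<close>

definition border_cof :: "(nat \<Rightarrow> nat \<Rightarrow> 'b::comm_ring_1) \<Rightarrow> nat \<Rightarrow> (nat \<Rightarrow> nat) \<Rightarrow> (nat \<Rightarrow> nat) \<Rightarrow> nat \<Rightarrow> nat \<Rightarrow> 'b" where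
  "border_cof M m f g j b = (-1) ^ (m + j) * minor M m f (g(m := b) \<circ> skip j)"

text \<open>Expansion along the new row. The cofactors do not depend on \<open>a\<close>, so for
  varying \<open>a\<close> and \<open>b\<close> the sum is a matrix product through the
  \<open>m\<close> columns \<open>g\<close>.\<close>

lemma minor_border:
  "minor M (Suc m) (f(m := a)) (g(m := b)) =
    M a b * minor M m f g + (\<Sum>j<m. M a (g j) * border_cof M m f g j b)"
proof -
  have *: "minor M m (f(m := a) \<circ> skip m) h = minor M m f h" for h
    by (rule minor_cong) (auto simp: skip_def)
  have **: "minor M m f (g(m := b) \<circ> skip m) = minor M m f g"
    by (rule minor_cong) (auto simp: skip_def)
  have "minor M (Suc m) (f(m := a)) (g(m := b)) = (\<Sum>j\<le>m. M a ((g(m := b)) j) *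
      ((-1) ^ (m + j) * minor M m f (g(m := b) \<circ> skip j)))"
    by (subst minor_laplace_row[of m]) (auto simp: *)
  also have "\<dots> = M a b * minor M m f g + (\<Sum>j<m. M a (g j) * border_cof M m f g j b)"
  proof -
    have "M a ((g(m := b)) m) * ((-1) ^ (m + m) * minor M m f (g(m := b) \<circ> skip m)) = M a b * minor M m f g"
      by (simp add: ** flip: mult_2)
    moreover have "(\<Sum>j<m. M a ((g(m := b)) j) * ((-1) ^ (m + j) * minor M m f (g(m := b) \<circ> skip j)))
        = (\<Sum>j<m. M a (g j) * border_cof M m f g j b)"
      by (intro sum.cong) (auto simp: border_cof_def)
    ultimately show ?thesis
      unfolding lessThan_Suc_atMost[symmetric] sum.lessThan_Suc by (simp only: add.commute)
  qed
  finally show ?thesis .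
qed

text \<open>Indices may repeat, so zero and sign changes are included. The generated ideal is the
  usual one, while monotonicity, transposition and reindexing need no cardinality or order
  conditions.\<close>

definition gens :: "(nat \<Rightarrow> nat \<Rightarrow> 'b::comm_ring_1) \<Rightarrow> nat \<Rightarrow> nat set \<Rightarrow> nat set \<Rightarrow> 'b set" where
  "gens M t A B = {minor M t f g | f g. f ` {..<t} \<subseteq> A \<and> g ` {..<t} \<subseteq> B}"

lemma minor_in_gens: "f ` {..<t} \<subseteq> A \<Longrightarrow> g ` {..<t} \<subseteq> B \<Longrightarrow> minor M t f g \<in> gens M t A B"
  by (auto simp: gens_def)

lemma gensE:
  assumes "F \<in> gens M t A B"
  obtains f g where "F = minor M t f g" "f ` {..<t} \<subseteq> A" "g ` {..<t} \<subseteq> B"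
  using assms by (auto simp: gens_def)

lemma gens_mono: "A \<subseteq> A' \<Longrightarrow> B \<subseteq> B' \<Longrightarrow> gens M t A B \<subseteq> gens M t A' B'"
  by (force elim!: gensE intro!: minor_in_gens)

lemma gens_transpose: "gens (\<lambda>i j. M j i) t B A = gens M t A B"
proof -
  have "gens (\<lambda>i j. M j i) t B A \<subseteq> gens M t A B" for M :: "nat \<Rightarrow> nat \<Rightarrow> 'a" and A B
    by (auto elim!: gensE simp: minor_transpose[of M] intro!: minor_in_gens)
  from this[of M] this[of "\<lambda>i j. M j i"] show ?thesis by blast
qed

lemma gens_subset_zero:
  assumes "finite A" "card A < t"
  shows "gens M t A B \<subseteq> {0}"
proof -
  have "\<not> inj_on f {..<t}" if "f ` {..<t} \<subseteq> A" for f :: "nat \<Rightarrow> nat"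
    using card_inj_on_le[OF _ that assms(1)] assms(2) by auto
  then show ?thesis by (auto simp: gens_def minor_not_inj_row)
qed

lemma gens_subset_zero_col: "finite B \<Longrightarrow> card B < t \<Longrightarrow> gens M t A B \<subseteq> {0}"
  using gens_subset_zero[of B t "\<lambda>i j. M j i" A] by (simp add: gens_transpose[of M])

text \<open>Laplace expansion along the position of the new row \<open>a\<close>, which injectivity
  makes unique; if \<open>a\<close> does not occur, any position serves.\<close>

lemma gens_insert_row:
  assumes "gens M t A B \<subseteq> idl S"
  shows "gens M (Suc t) (insert a A) B \<subseteq> idl S"
proof
  fix F assume "F \<in> gens M (Suc t) (insert a A) B"
  then obtain f g where F: "F = minor M (Suc t) f g" and f: "f ` {..<Suc t} \<subseteq> insert a A"
    and g: "g ` {..<Suc t} \<subseteq> B" by (rule gensE)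
  show "F \<in> idl S"
  proof (cases "inj_on f {..<Suc t}")
    case True
    have "\<exists>i\<le>t. \<forall>u\<le>t. u \<noteq> i \<longrightarrow> f u \<in> A"
    proof (cases "a \<in> f ` {..<Suc t}")
      case True
      then obtain i where "i \<le> t" "f i = a" by (auto simp: less_Suc_eq_le)
      moreover have "f u \<in> A" if "u \<le> t" "u \<noteq> i" for u
      proof -
        have "f u \<noteq> a"
          using inj_onD[OF \<open>inj_on f {..<Suc t}\<close>, of u i] that \<open>i \<le> t\<close> \<open>f i = a\<close> by auto
        moreover have "f u \<in> insert a A"
          using f that by (auto simp: image_subset_iff less_Suc_eq_le)
        ultimately show ?thesis by auto
      qed
      ultimately show ?thesis by blast
    next
      case False
      have "f u \<in> A" if "u \<le> t" for u
      proof -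
        have "f u \<in> f ` {..<Suc t}" using that by simp
        then show ?thesis using f False by auto
      qed
      then show ?thesis by blast
    qed
    then obtain i where i: "i \<le> t" "\<And>u. u \<le> t \<Longrightarrow> u \<noteq> i \<Longrightarrow> f u \<in> A" by blast
    have "minor M t (f \<circ> skip i) (g \<circ> skip j) \<in> gens M t A B" if "j \<le> t" for j
      by (rule minor_in_gens) (use i g that in \<open>auto simp: skip_def image_subset_iff\<close>)
    then show ?thesis
      unfolding F minor_laplace_row[OF i(1)]
      by (intro idl.span_sum idl.span_scale) (use assms in auto)
  qed (simp add: F minor_not_inj_row idl.span_zero)
qed

lemma gens_insert_col: "gens M t A B \<subseteq> idl S \<Longrightarrow> gens M (Suc t) A (insert b B) \<subseteq> idl S"
  using gens_insert_row[of "\<lambda>i j. M j i" t B A S b] by (simp add: gens_transpose[of M])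

lemma pivot_mult_minor:
  assumes "\<And>a b. a \<in> A \<Longrightarrow> b \<in> B \<Longrightarrow> minor M (Suc m) (f(m := a)) (g(m := b)) \<in> idl S"
    and "F \<in> gens M (Suc m) A B"
  shows "minor M m f g ^ Suc m * F \<in> idl S"
proof -
  let ?D = "minor M m f g"
  \<comment> \<open>Solving the bordered expansions for \<open>?D * M i j\<close>: modulo the
    bordering minors it equals \<open>?W\<close>, whose (m+1)-minors vanish. The exponent is the
    size of \<open>F\<close>, each of whose rows is scaled by \<open>?D\<close>.\<close>
  let ?W = "\<lambda>i j. \<Sum>c<m. M i (g c) * (- border_cof M m f g c j)"
  obtain f' g' where F: "F = minor M (Suc m) f' g'" and f: "f' ` {..<Suc m} \<subseteq> A"
    and g: "g' ` {..<Suc m} \<subseteq> B" using assms(2) by (rule gensE)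
  have "minor (\<lambda>i j. ?D * M i j) (Suc m) f' g' - minor ?W (Suc m) f' g' \<in> idl S"
  proof (rule minor_diff_mem_idl)
    fix a b assume "a < Suc m" "b < Suc m"
    then have "f' a \<in> A" "g' b \<in> B" using f g by auto
    then show "?D * M (f' a) (g' b) - ?W (f' a) (g' b) \<in> idl S"
      using assms(1)[of "f' a" "g' b"] by (simp add: minor_border sum_negf mult.commute)
  qed
  then show ?thesis
    unfolding minor_factor_zero[where U = "\<lambda>i c. M i (g c)"] by (simp add: minor_smult F)
qed

subsection \<open>Evaluation of multivariate polynomials\<close>

definition mon_eval :: "('x \<Rightarrow> 'c::comm_ring_1) \<Rightarrow> ('x \<Rightarrow>\<^sub>0 nat) \<Rightarrow> 'c" where
  "mon_eval v m = (\<Prod>x\<in>Poly_Mapping.keys m. v x ^ Poly_Mapping.lookup m x)"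

definition meval :: "('a::comm_ring_1 \<Rightarrow> 'c::comm_ring_1) \<Rightarrow> ('x \<Rightarrow> 'c) \<Rightarrow> ('x, 'a) mpoly \<Rightarrow> 'c" where
  "meval h v p = (\<Sum>m\<in>Poly_Mapping.keys p. h (Poly_Mapping.lookup p m) * mon_eval v m)"

lemma mon_eval_superset:
  assumes "finite A" "Poly_Mapping.keys m \<subseteq> A"
  shows "mon_eval v m = (\<Prod>x\<in>A. v x ^ Poly_Mapping.lookup m x)"
  unfolding mon_eval_def
  by (rule prod.mono_neutral_left) (use assms in \<open>auto simp: in_keys_iff\<close>)

lemma mon_eval_0 [simp]: "mon_eval v 0 = 1"
  by (simp add: mon_eval_def)

lemma mon_eval_add: "mon_eval v (m + n) = mon_eval v m * mon_eval v n"
proof -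
  let ?A = "Poly_Mapping.keys m \<union> Poly_Mapping.keys n"
  have "Poly_Mapping.keys (m + n) \<subseteq> ?A" by (rule Poly_Mapping.keys_add)
  then show ?thesis
    by (simp add: mon_eval_superset[of ?A] lookup_add power_add prod.distrib)
qed

lemma sum_single_keys: "(\<Sum>m\<in>Poly_Mapping.keys p. Poly_Mapping.single m (Poly_Mapping.lookup p m)) = p"
proof (rule poly_mapping_eqI)
  fix k
  have "Poly_Mapping.lookup (\<Sum>m\<in>Poly_Mapping.keys p. Poly_Mapping.single m (Poly_Mapping.lookup p m)) k
      = (\<Sum>m\<in>Poly_Mapping.keys p. if m = k then Poly_Mapping.lookup p m else 0)"
    by (simp add: lookup_sum lookup_single when_def)
  also have "\<dots> = Poly_Mapping.lookup p k"
    by (simp add: sum.delta' in_keys_iff)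
  finally show "Poly_Mapping.lookup (\<Sum>m\<in>Poly_Mapping.keys p. Poly_Mapping.single m (Poly_Mapping.lookup p m)) k = Poly_Mapping.lookup p k" .
qed

context comm_ring_hom
begin

lemma meval_superset:
  assumes "finite A" "Poly_Mapping.keys p \<subseteq> A"
  shows "meval hom v p = (\<Sum>m\<in>A. hom (Poly_Mapping.lookup p m) * mon_eval v m)"
  unfolding meval_def
  by (rule sum.mono_neutral_left) (use assms in \<open>auto simp: in_keys_iff\<close>)

lemma meval_add: "meval hom v (p + q) = meval hom v p + meval hom v q"
proof -
  let ?A = "Poly_Mapping.keys p \<union> Poly_Mapping.keys q"
  have "Poly_Mapping.keys (p + q) \<subseteq> ?A" by (rule Poly_Mapping.keys_add)
  then show ?thesis
    by (simp add: meval_superset[of ?A] lookup_add hom_add distrib_right sum.distrib)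
qed

lemma meval_0 [simp]: "meval hom v 0 = 0"
  by (simp add: meval_def)

lemma meval_single: "meval hom v (Poly_Mapping.single m c) = hom c * mon_eval v m"
  by (simp add: meval_def)

lemma meval_sum: "meval hom v (sum u A) = (\<Sum>i\<in>A. meval hom v (u i))"
  by (induction A rule: infinite_finite_induct) (auto simp: meval_add)

lemma meval_mult: "meval hom v (p * q) = meval hom v p * meval hom v q"
proof -
  have "p * q = (\<Sum>m\<in>Poly_Mapping.keys p. Poly_Mapping.single m (Poly_Mapping.lookup p m)) *
      (\<Sum>n\<in>Poly_Mapping.keys q. Poly_Mapping.single n (Poly_Mapping.lookup q n))"
    by (simp only: sum_single_keys)
  also have "\<dots> = (\<Sum>m\<in>Poly_Mapping.keys p. \<Sum>n\<in>Poly_Mapping.keys q.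
      Poly_Mapping.single (m + n) (Poly_Mapping.lookup p m * Poly_Mapping.lookup q n))"
    by (simp add: sum_product mult_single)
  finally have "meval hom v (p * q) = (\<Sum>m\<in>Poly_Mapping.keys p. \<Sum>n\<in>Poly_Mapping.keys q.
      (hom (Poly_Mapping.lookup p m) * mon_eval v m) * (hom (Poly_Mapping.lookup q n) * mon_eval v n))"
    by (simp add: meval_sum meval_single mon_eval_add hom_mult mult_ac)
  then show ?thesis
    unfolding meval_def sum_product .
qed

lemma comm_ring_hom_meval: "comm_ring_hom (meval hom v)"
proof
  show "meval hom v 1 = 1"
    using meval_single[of v 0 1] by simp
qed (auto simp: meval_add meval_mult)

lemma meval_indet [simp]: "meval hom v (indet x) = v x"
  by (simp add: indet_def meval_single mon_eval_def)

end

lemma comm_ring_hom_single: "comm_ring_hom (\<lambda>c::'a::comm_ring_1. Poly_Mapping.single 0 c :: ('x, 'a) mpoly)"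
  by standard (auto simp: single_add mult_single)

lemma single_eq_prod_indet:
  "Poly_Mapping.single m (1::'a::comm_ring_1) = (\<Prod>x\<in>Poly_Mapping.keys m. indet x ^ Poly_Mapping.lookup m x)"
proof -
  have pow: "(indet x :: ('x, 'a) mpoly) ^ n = Poly_Mapping.single (Poly_Mapping.single x n) 1" for x :: 'x and n
    by (induction n) (auto simp: indet_def mult_single simp flip: single_add)
  have prod: "(\<Prod>x\<in>A. Poly_Mapping.single (u x) (1::'a)) = Poly_Mapping.single (sum u A) 1" for u :: "'x \<Rightarrow> 'x \<Rightarrow>\<^sub>0 nat" and A
    by (induction A rule: infinite_finite_induct) (auto simp: mult_single)
  show ?thesis
    by (simp add: pow prod sum_single_keys)
qed

text \<open>Uniqueness in the universal property: constants and indeterminates determine a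
  homomorphism.\<close>

lemma hom_eq_meval:
  fixes hom :: "('x, 'a::comm_ring_1) mpoly \<Rightarrow> 'c::comm_ring_1"
  assumes "comm_ring_hom hom"
  shows "hom p = meval (\<lambda>c. hom (Poly_Mapping.single 0 c)) (\<lambda>x. hom (indet x)) p"
proof -
  interpret comm_ring_hom hom by fact
  have "hom p = hom (\<Sum>m\<in>Poly_Mapping.keys p. Poly_Mapping.single 0 (Poly_Mapping.lookup p m) * Poly_Mapping.single m 1)"
    by (simp add: mult_single sum_single_keys)
  also have "\<dots> = (\<Sum>m\<in>Poly_Mapping.keys p. hom (Poly_Mapping.single 0 (Poly_Mapping.lookup p m)) *
      (\<Prod>x\<in>Poly_Mapping.keys m. hom (indet x) ^ Poly_Mapping.lookup m x))"
    by (simp add: hom_sum hom_mult single_eq_prod_indet hom_prod hom_power)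
  finally show ?thesis
    by (simp add: meval_def mon_eval_def)
qed

lemma meval_single_indet: "meval (Poly_Mapping.single 0) indet p = p"
  by (simp add: meval_def mon_eval_def mult_single sum_single_keys flip: single_eq_prod_indet)

lemma meval_cong:
  assumes "\<And>m x. m \<in> Poly_Mapping.keys p \<Longrightarrow> x \<in> Poly_Mapping.keys m \<Longrightarrow> v x = w x"
  shows "meval h v p = meval h w p"
  unfolding meval_def mon_eval_def
  by (intro sum.cong prod.cong arg_cong2[where f = "(*)"] refl) (use assms in auto)

text \<open>The coefficients keep the type of the argument although \<open>y\<close> does not occur
  in them, so that they can be tested directly for membership in the ideals.\<close>

definition split_var :: "'x \<Rightarrow> ('x, 'a::comm_ring_1) mpoly \<Rightarrow> ('x, 'a) mpoly poly" where
  "split_var y = meval (\<lambda>c. [:Poly_Mapping.single 0 c:]) (\<lambda>x. if x = y then [:0, 1:] else [:indet x:])"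

interpretation split_var: comm_ring_hom "split_var y :: ('x, 'a::comm_ring_1) mpoly \<Rightarrow> ('x, 'a) mpoly poly"
proof -
  interpret comm_ring_hom "\<lambda>c::'a. [:Poly_Mapping.single 0 c :: ('x, 'a) mpoly:]"
    by standard (auto simp: single_add mult_single one_pCons mult.commute)
  show "comm_ring_hom (split_var y :: ('x, 'a) mpoly \<Rightarrow> ('x, 'a) mpoly poly)"
    unfolding split_var_def by (rule comm_ring_hom_meval)
qed

lemma split_var_const: "split_var y (Poly_Mapping.single 0 c) = [:Poly_Mapping.single 0 c:]"
  by (simp add: split_var_def meval_def)

lemma split_var_indet: "split_var y (indet x) = (if x = y then [:0, 1:] else [:indet x:])"
  by (simp add: split_var_def meval_def indet_def mon_eval_def)

lemma poly_split_var:
  fixes p :: "('x, 'a::comm_ring_1) mpoly"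
  shows "poly (split_var y p) (indet y) = p"
proof -
  have "comm_ring_hom (\<lambda>p :: ('x, 'a) mpoly. poly (split_var y p) (indet y))"
    by standard (auto simp: split_var.hom_add split_var.hom_mult split_var.hom_one split_var.hom_zero)
  from hom_eq_meval[OF this, of p]
  have "poly (split_var y p) (indet y) =
      meval (Poly_Mapping.single 0) (\<lambda>x. if x = y then indet y else indet x) p"
    by (simp add: split_var_const split_var_indet if_distrib[of "\<lambda>q. poly q _"] cong: if_cong)
  moreover have "(\<lambda>x. if x = y then indet y else indet x :: ('x, 'a) mpoly) = indet"
    by auto
  ultimately show ?thesis by (simp add: meval_single_indet)
qed

subsection \<open>Homogenised evaluation of univariate polynomials\<close>

text \<open>For \<open>degree F \<le> n\<close> this is \<open>q ^ n * F (r / q)\<close>, written without division.\<close>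

definition hev :: "'b::comm_ring_1 \<Rightarrow> 'b \<Rightarrow> nat \<Rightarrow> 'b poly \<Rightarrow> 'b" where
  "hev q r n F = (\<Sum>i\<le>n. coeff F i * r ^ i * q ^ (n - i))"

lemma hev_add: "hev q r n (F + G) = hev q r n F + hev q r n G"
  by (simp add: hev_def distrib_right sum.distrib)

lemma hev_0 [simp]: "hev q r n 0 = 0"
  by (simp add: hev_def)

lemma hev_diff: "hev q r n (F - G) = hev q r n F - hev q r n G"
  by (simp add: hev_def left_diff_distrib sum_subtractf)

lemma hev_smult: "hev q r n (smult a F) = a * hev q r n F"
  by (simp add: hev_def sum_distrib_left mult.assoc)

lemma hev_sum: "hev q r n (sum u A) = (\<Sum>i\<in>A. hev q r n (u i))"
  by (induction A rule: infinite_finite_induct) (auto simp: hev_add)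

lemma hev_const [simp]: "hev q r n [:a:] = a * q ^ n"
  by (cases n) (auto simp: hev_def sum.atMost_Suc_shift simp del: sum.atMost_Suc)

lemma hev_pCons_0: "hev q r (Suc n) (pCons 0 F) = r * hev q r n F"
  unfolding hev_def sum.atMost_Suc_shift by (simp add: sum_distrib_left mult_ac)

text \<open>The bound \<open>n\<close> matters only up to powers of \<open>q\<close>; modulo a prime
  ideal without \<open>q\<close> these cancel.\<close>

lemma hev_raise: "degree F \<le> n \<Longrightarrow> hev q r (Suc n) F = q * hev q r n F"
  by (auto simp: hev_def sum_distrib_left coeff_eq_0 Suc_diff_le mult_ac intro!: sum.cong)

lemma hev_raise_add: "degree F \<le> n \<Longrightarrow> hev q r (m + n) F = q ^ m * hev q r n F"
  by (induction m) (auto simp: hev_raise mult.assoc)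

lemma hev_mult:
  assumes "degree F \<le> m" "degree G \<le> n"
  shows "hev q r (m + n) (F * G) = hev q r m F * hev q r n G"
  using assms(1)
proof (induction F arbitrary: m)
  case (pCons a F)
  have F: "pCons a F = [:a:] + pCons 0 F" by simp
  show ?case
  proof (cases m)
    case 0
    then have "F = 0" using pCons.prems by (auto split: if_splits)
    then show ?thesis using 0 by (simp add: hev_smult)
  next
    case (Suc m')
    then have "degree F \<le> m'" using pCons.prems by (auto split: if_splits)
    then have IH: "hev q r (m' + n) (F * G) = hev q r m' F * hev q r n G" by (rule pCons.IH)
    have "hev q r (m + n) (pCons a F * G) = a * (q ^ m * hev q r n G) + r * (hev q r m' F * hev q r n G)"
      using hev_raise_add[OF assms(2), of q r m] hev_pCons_0[of q r "m' + n" "F * G"]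
      by (simp add: hev_add hev_smult IH Suc)
    also have "\<dots> = hev q r m (pCons a F) * hev q r n G"
      unfolding F hev_add using Suc by (simp add: hev_pCons_0 algebra_simps)
    finally show ?thesis .
  qed
qed simp

lemma degree_prod_le: "finite A \<Longrightarrow> (\<And>i. i \<in> A \<Longrightarrow> degree (u i :: 'b::comm_ring_1 poly) \<le> 1) \<Longrightarrow> degree (prod u A) \<le> card A"
proof (induction A rule: finite_induct)
  case (insert x A)
  have "degree (prod u (insert x A)) \<le> degree (u x) + degree (prod u A)"
    using insert by (simp add: degree_mult_le)
  also have "\<dots> \<le> 1 + card A"
    using insert by (intro add_mono) auto
  finally show ?case using insert by simp
qed simp

lemma hev_prod:
  assumes "finite A" "\<And>i. i \<in> A \<Longrightarrow> degree (u i) \<le> 1"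
  shows "hev q r (card A) (prod u A) = (\<Prod>i\<in>A. hev q r 1 (u i))"
  using assms
proof (induction A rule: finite_induct)
  case (insert x A)
  then show ?case
    using hev_mult[of "u x" 1 "prod u A" "card A" q r] degree_prod_le[of A u] by simp
qed (simp add: hev_def)

lemma degree_minor_le:
  assumes "\<And>a b. a < t \<Longrightarrow> b < t \<Longrightarrow> degree (M (f a) (g b)) \<le> 1"
  shows "degree (minor M t f g) \<le> t"
  unfolding minor_leibniz
proof (rule degree_sum_le)
  fix p assume "p \<in> {p. p permutes {0..<t}}"
  then have "degree (\<Prod>i = 0..<t. M (f i) (g (p i))) \<le> card {0..<t}"
    by (intro degree_prod_le assms) (auto dest: permutes_in_image)
  then show "degree (signof p * (\<Prod>i = 0..<t. M (f i) (g (p i)))) \<le> t"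
    by (auto simp: sign_def)
qed (simp add: finite_permutations)

text \<open>Every Leibniz term has \<open>t\<close> factors of degree at most one, so
  \<open>q ^ t\<close> supplies exactly one \<open>q\<close> per entry.\<close>

lemma hev_minor:
  assumes "\<And>a b. a < t \<Longrightarrow> b < t \<Longrightarrow> degree (M (f a) (g b)) \<le> 1"
  shows "hev q r t (minor M t f g) = minor (\<lambda>i j. hev q r 1 (M i j)) t f g"
  unfolding minor_leibniz hev_sum
proof (rule sum.cong)
  fix p assume "p \<in> {p. p permutes {0..<t}}"
  then have "hev q r (card {0..<t}) (\<Prod>i = 0..<t. M (f i) (g (p i))) = (\<Prod>i = 0..<t. hev q r 1 (M (f i) (g (p i))))"
    by (intro hev_prod assms) (auto dest: permutes_in_image)
  moreover have "hev q r t (- F) = - hev q r t F" for F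
    using hev_diff[of q r t 0 F] by simp
  ultimately show "hev q r t (signof p * (\<Prod>i = 0..<t. M (f i) (g (p i)))) =
      signof p * (\<Prod>i = 0..<t. hev q r 1 (M (f i) (g (p i))))"
    by (auto simp: sign_def)
qed simp

text \<open>Modulo \<open>N\<close> the polynomials in \<open>I\<close> are those vanishing at
  \<open>y = r / q\<close>; the top coefficient of such a polynomial lies in \<open>C\<close>, so it can be cancelled by a
  linear element of \<open>I\<close>.\<close>

lemma mem_of_hev_mem:
  fixes y q r :: "'b::comm_ring_1"
  assumes N: "prime_like (idl N)" "idl N \<subseteq> idl I" "idl N \<subseteq> idl C"
    and q: "q \<in> idl C" "q \<notin> idl N"
    and r: "\<And>c. r * c \<in> idl C \<Longrightarrow> c \<in> idl C"
    and lift: "\<And>c. c \<in> idl C \<Longrightarrow> \<exists>d. c * y + d \<in> idl I \<and> hev q r 1 [:d, c:] \<in> idl N"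
    and "degree F \<le> n" "hev q r n F \<in> idl N"
  shows "poly F y \<in> idl I"
  using assms(8,9)
proof (induction n arbitrary: F)
  case 0
  then obtain a where "F = [:a:]" by (metis degree_eq_zeroE le_zero_eq)
  then show ?case using 0 N(2) by (auto simp: hev_def)
next
  case (Suc n)
  \<comment> \<open>All terms below the top one carry the factor \<open>q\<close> of
    \<open>idl C\<close>, and the whole value lies in \<open>idl N\<close>, hence in
    \<open>idl C\<close>. What remains is \<open>?c * r ^ Suc n\<close>, and \<open>r\<close>
    cancels modulo \<open>idl C\<close>.\<close>
  let ?c = "coeff F (Suc n)"
  have "hev q r (Suc n) F = ?c * r ^ Suc n + q * (\<Sum>i\<le>n. coeff F i * r ^ i * q ^ (n - i))"
    unfolding hev_def by (simp add: sum_distrib_left Suc_diff_le mult_ac)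
  then have "?c * r ^ Suc n = hev q r (Suc n) F - q * (\<Sum>i\<le>n. coeff F i * r ^ i * q ^ (n - i))"
    by simp
  also have "\<dots> \<in> idl C"
    using Suc.prems N(3) q by (intro idl.span_diff idl_mult_right) auto
  finally have *: "r ^ Suc n * ?c \<in> idl C" by (simp add: mult.commute)
  have "r ^ k * ?c \<in> idl C \<Longrightarrow> ?c \<in> idl C" for k
    by (induction k) (auto simp: mult.assoc intro: r)
  then have "?c \<in> idl C" using * by blast
  then obtain d where d: "?c * y + d \<in> idl I" "hev q r 1 [:d, ?c:] \<in> idl N"
    using lift by blast
  \<comment> \<open>Subtracting \<open>G\<close> removes the top coefficient and keeps the value in
    \<open>idl N\<close>; at the lower degree a spare factor \<open>q\<close> splits off and
    cancels.\<close>
  define G where "G = monom 1 n * [:d, ?c:]"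
  have G: "degree G \<le> Suc n" "coeff G (Suc n) = ?c" "poly G y = y ^ n * (?c * y + d)"
  proof -
    have "degree G \<le> n + 1"
      unfolding G_def by (intro order.trans[OF degree_mult_le] add_mono degree_monom_le) auto
    then show "degree G \<le> Suc n" by simp
    show "coeff G (Suc n) = ?c"
      using coeff_monom_mult[of 1 n "[:d, ?c:]" "Suc n"] by (simp add: G_def Suc_diff_le)
    show "poly G y = y ^ n * (?c * y + d)"
      by (simp add: G_def poly_monom algebra_simps)
  qed
  have "hev q r (n + 1) G = hev q r n (monom 1 n) * hev q r 1 [:d, ?c:]"
    unfolding G_def by (rule hev_mult) (auto simp: degree_monom_le)
  then have "hev q r (Suc n) G \<in> idl N"
    using d by (simp add: idl.span_scale)
  then have FG: "hev q r (Suc n) (F - G) \<in> idl N"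
    unfolding hev_diff using Suc.prems by (intro idl.span_diff)
  have deg: "degree (F - G) \<le> n"
  proof (rule degree_le, intro allI impI)
    fix i assume "n < i"
    then show "coeff (F - G) i = 0"
      using G Suc.prems by (cases "i = Suc n") (auto simp: coeff_eq_0)
  qed
  have "q * hev q r n (F - G) \<in> idl N"
    using FG hev_raise[OF deg] by simp
  then have "hev q r n (F - G) \<in> idl N"
    using N(1) q(2) prime_likeD by blast
  then have "poly (F - G) y \<in> idl I"
    using Suc.IH deg by blast
  moreover have "poly G y \<in> idl I"
    unfolding G using d by (intro idl.span_scale)
  ultimately have "poly (F - G) y + poly G y \<in> idl I"
    by (rule idl.span_add)
  then show ?case by simp
qed

text \<open>By \<open>lift\<close>, \<open>C\<close> consists of leading coefficients of linear
  elements of \<open>idl I\<close> that vanish at \<open>y = r / q\<close>. This makes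
  \<open>idl I\<close> the set of polynomials whose homogenised value lies in \<open>idl N\<close>,
  and that value is multiplicative.\<close>

lemma prime_like_extend:
  fixes y :: 'x and q r :: "('x, 'a::comm_ring_1) mpoly"
  assumes N: "prime_like (idl N)" "idl N \<subseteq> idl I" "idl N \<subseteq> idl C"
    and q: "q \<in> idl C" "q \<notin> idl N"
    and r: "\<And>c. r * c \<in> idl C \<Longrightarrow> c \<in> idl C"
    and lift: "\<And>c. c \<in> C \<Longrightarrow> \<exists>d. c * indet y + d \<in> idl I \<and> hev q r 1 [:d, c:] \<in> idl N"
    and I: "\<And>F. F \<in> I \<Longrightarrow> \<exists>n. degree (split_var y F) \<le> n \<and> hev q r n (split_var y F) \<in> idl N"
  shows "prime_like (idl I)"
proof -
  \<comment> \<open>Some bound \<open>n\<close> is asked for instead of the degree, so that sums and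
    multiples may raise it at the cost of factors \<open>q\<close>.\<close>
  define Z where "Z = {F. \<exists>n. degree (split_var y F) \<le> n \<and> hev q r n (split_var y F) \<in> idl N}"
  have "idl I \<subseteq> Z"
  proof (rule idl.span_minimal)
    show "idl.subspace Z"
    proof (rule idl.subspaceI)
      show "0 \<in> Z" by (auto simp: Z_def idl.span_zero)
      fix F G assume "F \<in> Z" "G \<in> Z"
      then obtain m n where F: "degree (split_var y F) \<le> m" "hev q r m (split_var y F) \<in> idl N"
        and G: "degree (split_var y G) \<le> n" "hev q r n (split_var y G) \<in> idl N"
        by (auto simp: Z_def)
      have "degree (split_var y (F + G)) \<le> m + n"
        using F G by (auto simp: split_var.hom_add intro!: degree_add_le)
      moreover have "hev q r (m + n) (split_var y (F + G)) \<in> idl N"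
        using hev_raise_add[OF F(1), of q r n] hev_raise_add[OF G(1), of q r m] F G
        by (auto simp: split_var.hom_add hev_add add.commute[of m n] intro!: idl.span_add idl.span_scale)
      ultimately show "F + G \<in> Z" unfolding Z_def by blast
    next
      fix a F :: "('x, 'a) mpoly" assume "F \<in> Z"
      then obtain m where F: "degree (split_var y F) \<le> m" "hev q r m (split_var y F) \<in> idl N"
        by (auto simp: Z_def)
      let ?n = "degree (split_var y a)"
      have "degree (split_var y (a * F)) \<le> ?n + m"
        unfolding split_var.hom_mult using F by (intro order.trans[OF degree_mult_le]) simp
      moreover have "hev q r (?n + m) (split_var y (a * F)) \<in> idl N"
        unfolding split_var.hom_mult using F by (simp add: hev_mult idl.span_scale)
      ultimately show "a * F \<in> Z" unfolding Z_def by blast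
    qed
  qed (use I in \<open>auto simp: Z_def\<close>)
  define L where "L = {c. \<exists>d. c * indet y + d \<in> idl I \<and> hev q r 1 [:d, c:] \<in> idl N}"
  have "idl C \<subseteq> L"
  proof (rule idl.span_minimal)
    show "idl.subspace L"
    proof (rule idl.subspaceI)
      show "0 \<in> L" by (auto simp: L_def idl.span_zero intro!: exI[of _ 0])
      fix b c assume "b \<in> L" "c \<in> L"
      then obtain d e where "b * indet y + d \<in> idl I" "hev q r 1 [:d, b:] \<in> idl N"
        "c * indet y + e \<in> idl I" "hev q r 1 [:e, c:] \<in> idl N" by (auto simp: L_def)
      then have "(b + c) * indet y + (d + e) \<in> idl I" "hev q r 1 [:d + e, b + c:] \<in> idl N"
        using idl.span_add[of "b * indet y + d" I "c * indet y + e"]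
          idl.span_add[of "hev q r 1 [:d, b:]" N "hev q r 1 [:e, c:]"]
        by (simp_all add: algebra_simps flip: hev_add)
      then show "b + c \<in> L" unfolding L_def by blast
    next
      fix a c assume "c \<in> L"
      then obtain d where "c * indet y + d \<in> idl I" "hev q r 1 [:d, c:] \<in> idl N" by (auto simp: L_def)
      then have "(a * c) * indet y + a * d \<in> idl I" "hev q r 1 [:a * d, a * c:] \<in> idl N"
        using idl.span_scale[of "c * indet y + d" I a] idl.span_scale[of "hev q r 1 [:d, c:]" N a]
        by (simp_all add: algebra_simps flip: hev_smult)
      then show "a * c \<in> L" unfolding L_def by blast
    qed
  qed (use lift in \<open>auto simp: L_def\<close>)
  then have lift': "\<exists>d. c * indet y + d \<in> idl I \<and> hev q r 1 [:d, c:] \<in> idl N" if "c \<in> idl C" for c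
    using that by (auto simp: L_def)
  have mem: "F \<in> idl I" if "hev q r (degree (split_var y F)) (split_var y F) \<in> idl N" for F
    using mem_of_hev_mem[where F = "split_var y F" and y = "indet y", OF N q r lift' order.refl that]
    by (simp add: poly_split_var)
  show ?thesis
    unfolding prime_like_def
  proof (intro allI impI)
    fix F G assume "F * G \<in> idl I"
    then obtain n where n: "degree (split_var y (F * G)) \<le> n" "hev q r n (split_var y (F * G)) \<in> idl N"
      using \<open>idl I \<subseteq> Z\<close> by (auto simp: Z_def)
    \<comment> \<open>\<open>hev_mult\<close> yields the sum of the two degrees as bound, while
      membership in \<open>Z\<close> gives an unrelated \<open>n\<close>; the two values are
      compared at \<open>n + ?m\<close>.\<close>
    let ?m = "degree (split_var y F) + degree (split_var y G)"
    have "degree (split_var y (F * G)) \<le> ?m"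
      unfolding split_var.hom_mult by (rule degree_mult_le)
    then have "hev q r (n + ?m) (split_var y (F * G)) = q ^ n * hev q r ?m (split_var y (F * G))"
      by (rule hev_raise_add)
    moreover have "hev q r (?m + n) (split_var y (F * G)) = q ^ ?m * hev q r n (split_var y (F * G))"
      using n(1) by (rule hev_raise_add)
    ultimately have "q ^ n * hev q r ?m (split_var y (F * G)) \<in> idl N"
      using n(2) by (simp add: add.commute idl.span_scale)
    then have "hev q r ?m (split_var y (F * G)) \<in> idl N"
      using N(1) q(2) prime_like_power_mult by blast
    then show "F \<in> idl I \<or> G \<in> idl I"
      using mem N(1) by (auto simp: split_var.hom_mult hev_mult dest: prime_likeD)
  qed
qed

subsection \<open>Ladder ideals and their primality\<close>

lemma idl_eqI: "S \<subseteq> idl T \<Longrightarrow> T \<subseteq> idl S \<Longrightarrow> idl S = idl T"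
  by (simp add: subset_antisym idl_subsetI)

lemma idl_subset_zero: "S \<subseteq> {0} \<Longrightarrow> S \<subseteq> idl T"
  using idl.span_zero[of T] by blast

lemma (in comm_ring_hom) hom_minor: "hom (minor M t f g) = minor (\<lambda>i j. hom (M i j)) t f g"
proof -
  have "map_mat hom (mat t t (\<lambda>(a, b). M (f a) (g b))) = mat t t (\<lambda>(a, b). hom (M (f a) (g b)))"
    by (intro eq_matI) auto
  then show ?thesis
    unfolding minor_def hom_det[symmetric] by simp
qed

section \<open>Non-membership by specialisation to 0-1 matrices\<close>

lemma notin_idl_if_hom:
  assumes "comm_ring_hom h" "\<And>s. s \<in> S \<Longrightarrow> h s = 0" "h z \<noteq> 0"
  shows "z \<notin> idl S"
proof
  interpret comm_ring_hom h by fact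
  assume "z \<in> idl S"
  moreover have "idl S \<subseteq> {z. h z = 0}"
    by (rule idl.span_minimal) (use assms in \<open>auto intro!: idl.subspaceI simp: hom_add hom_mult\<close>)
  ultimately show False using assms by auto
qed

lemma image_upd_lessThan_Suc: "(f(m := a)) ` {..<Suc m} = insert a (f ` {..<m})"
proof -
  have "(f(m := a)) ` {..<m} = f ` {..<m}" by (intro image_cong) auto
  then show ?thesis by (simp only: lessThan_Suc image_insert fun_upd_same)
qed

lemma inj_on_upd_lessThan_Suc:
  assumes "inj_on f {..<m}" "a \<notin> f ` {..<m}"
  shows "inj_on (f(m := a)) {..<Suc m}"
  unfolding lessThan_Suc inj_on_insert using inj_on_fun_updI[OF assms] assms(2) by simp

text \<open>For injective \<open>f\<close> and \<open>g\<close> a partial permutation matrix: the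
  rank of a block is the number of ones in it.\<close>

definition match_mat :: "nat \<Rightarrow> (nat \<Rightarrow> nat) \<Rightarrow> (nat \<Rightarrow> nat) \<Rightarrow> nat \<Rightarrow> nat \<Rightarrow> 'a::comm_ring_1" where
  "match_mat n f g i j = (if \<exists>m<n. i = f m \<and> j = g m then 1 else 0)"

lemma minor_match_mat:
  assumes "inj_on f {..<n}" "inj_on g {..<n}"
  shows "minor (match_mat n f g) n f g = (1 :: 'a::comm_ring_1)"
proof -
  have "(\<exists>m<n. f a = f m \<and> g b = g m) \<longleftrightarrow> a = b" if "a < n" "b < n" for a b
    using that inj_onD[OF assms(1), of a] inj_onD[OF assms(2), of b] by auto
  then have "mat n n (\<lambda>(a, b). match_mat n f g (f a) (g b)) = (1\<^sub>m n :: 'a mat)"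
    by (intro eq_matI) (auto simp: match_mat_def)
  then show ?thesis by (simp add: minor_def)
qed

text \<open>Fewer than \<open>t\<close> columns of the block contain a one, so among
  \<open>t\<close> distinct columns some column vanishes.\<close>

lemma minor_match_mat_zero:
  assumes "card {m. m < n \<and> f m \<in> A \<and> g m \<in> B} < t"
    and "z \<in> gens (match_mat n f g) t A B"
  shows "z = 0"
  using assms(2)
proof (rule gensE)
  fix f' g' assume z: "z = minor (match_mat n f g) t f' g'"
    and f': "f' ` {..<t} \<subseteq> A" and g': "g' ` {..<t} \<subseteq> B"
  let ?T = "g ` {m. m < n \<and> f m \<in> A \<and> g m \<in> B}"
  have T: "finite ?T" "card ?T < t"
    using assms(1) card_image_le[of "{m. m < n \<and> f m \<in> A \<and> g m \<in> B}" g] by auto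
  show "z = 0"
  proof (cases "inj_on g' {..<t}")
    case True
    then have "\<not> g' ` {..<t} \<subseteq> ?T"
      using T card_mono[of ?T "g' ` {..<t}"] by (auto simp: card_image)
    then obtain b where b: "b < t" "g' b \<notin> ?T" by auto
    have "match_mat n f g (f' a) (g' b) = 0" if "a < t" for a
    proof -
      have "f' a \<in> A" "g' b \<in> B" using b f' g' that by auto
      then show ?thesis using b(2) by (auto simp: match_mat_def)
    qed
    then show ?thesis
      unfolding z by (intro minor_zero_col[of b] b)
  qed (simp add: z minor_not_inj_col)
qed

text \<open>Absence of \<open>y\<close> as a fixed-point equation, so that closure under ring
  operations is the homomorphism property of \<open>split_var y\<close>.\<close>

definition var_free :: "'x \<Rightarrow> ('x, 'a::comm_ring_1) mpoly set" where
  "var_free y = {z. split_var y z = [:z:]}"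

lemma var_free_add: "a \<in> var_free y \<Longrightarrow> b \<in> var_free y \<Longrightarrow> a + b \<in> var_free y"
  and var_free_mult: "a \<in> var_free y \<Longrightarrow> b \<in> var_free y \<Longrightarrow> a * b \<in> var_free y"
  and var_free_uminus: "a \<in> var_free y \<Longrightarrow> - a \<in> var_free y"
  and var_free_0: "0 \<in> var_free y"
  and var_free_1: "1 \<in> var_free y"
  by (auto simp: var_free_def split_var.hom_add split_var.hom_mult split_var.hom_uminus one_pCons mult.commute)

lemma var_free_sum: "(\<And>i. i \<in> A \<Longrightarrow> u i \<in> var_free y) \<Longrightarrow> sum u A \<in> var_free y"
  by (induction A rule: infinite_finite_induct) (auto intro: var_free_add var_free_0)

lemma var_free_minor:
  assumes "\<And>a b. a < t \<Longrightarrow> b < t \<Longrightarrow> M (f a) (g b) \<in> var_free y"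
  shows "minor M t f g \<in> var_free y"
  by (rule minor_closed)
     (auto intro: assms var_free_add var_free_mult var_free_0 var_free_1 var_free_uminus)

lemma var_free_border_cof:
  assumes "\<And>a j. a < m \<Longrightarrow> j \<in> insert b (g ` {..<m}) \<Longrightarrow> M (f a) j \<in> var_free y"
  shows "border_cof M m f g i b \<in> var_free y"
proof -
  have "minor M m f (g(m := b) \<circ> skip i) \<in> var_free y"
    by (rule var_free_minor) (auto simp: skip_def intro!: assms)
  moreover have "(-1) ^ n \<in> var_free y" for n
    by (induction n) (auto intro: var_free_1 var_free_uminus)
  ultimately show ?thesis
    unfolding border_cof_def by (intro var_free_mult)
qed

lemma var_free_indet: "x \<noteq> y \<Longrightarrow> indet x \<in> var_free y"
  by (simp add: var_free_def split_var_indet)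

lemma hev_linear: "hev q r (Suc 0) [:d, c:] = d * q + c * r"
  by (simp add: hev_def)

text \<open>A bound \<open>\<tau> i - 1\<close> on the rank of the first \<open>i\<close> rows.\<close>

definition rank_profile :: "(nat \<Rightarrow> nat) \<Rightarrow> bool" where
  "rank_profile \<tau> \<longleftrightarrow> \<tau> 0 = 1 \<and> (\<forall>i. \<tau> i \<le> \<tau> (Suc i) \<and> \<tau> (Suc i) \<le> Suc (\<tau> i))"

lemma rank_profile_mono: "rank_profile \<tau> \<Longrightarrow> i \<le> j \<Longrightarrow> \<tau> i \<le> \<tau> j"
  by (rule lift_Suc_mono_le) (auto simp: rank_profile_def)

text \<open>A discrete intermediate value argument: the profile starts at 1 and rises by at most one
  per row. The jumps supply the pivot rows of the extension step.\<close>

lemma rank_profile_jump: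
  assumes "rank_profile \<tau>" "u + 2 \<le> \<tau> p"
  shows "\<exists>i<p. \<tau> i = u + 1 \<and> \<tau> (Suc i) = u + 2"
  using assms(2)
proof (induction p)
  case 0
  then show ?case using assms by (simp add: rank_profile_def)
next
  case (Suc p)
  show ?case
  proof (cases "u + 2 \<le> \<tau> p")
    case True
    then show ?thesis using Suc by (meson less_Suc_eq)
  next
    case False
    then show ?thesis
      using Suc.prems assms(1) by (intro exI[of _ p]) (auto simp: rank_profile_def not_le dest: spec[of _ p])
  qed
qed

text \<open>With an arbitrary injective labelling, transposes and reindexed matrices are instances
  too. The order on labels makes exponent vectors linearly ordered, which gives polynomials without
  zero divisors.\<close>

locale generic_entries =
  fixes \<xi> :: "nat \<Rightarrow> nat \<Rightarrow> 'x::linorder" and M :: "nat \<Rightarrow> nat \<Rightarrow> ('x, 'a::field) mpoly"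
  assumes inj: "\<xi> i j = \<xi> i' j' \<Longrightarrow> i = i' \<and> j = j'"
    and M: "M i j = indet (\<xi> i j)"
begin

text \<open>Injectivity of \<open>\<xi>\<close> makes the entries independent, so they can be sent
  to any scalar matrix; the remaining indeterminates get arbitrary values.\<close>

lemma ex_specialization:
  obtains h :: "('x, 'a) mpoly \<Rightarrow> 'a" where "comm_ring_hom h"
    "\<And>t f g. h (minor M t f g) = minor A t f g" "\<And>i j. h (M i j) = A i j"
    "\<And>t B C z. z \<in> gens M t B C \<Longrightarrow> h z \<in> gens A t B C"
proof -
  interpret id: comm_ring_hom "\<lambda>x::'a. x" by standard auto
  define v where "v x = (let (i, j) = (SOME (i, j). \<xi> i j = x) in A i j)" for x
  have v: "v (\<xi> i j) = A i j" for i j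
  proof -
    have "(SOME (i', j'). \<xi> i' j' = \<xi> i j) = (i, j)"
      by (rule some_equality) (auto dest: inj)
    then show ?thesis by (simp add: v_def)
  qed
  let ?h = "meval (\<lambda>x::'a. x) v"
  have h: "comm_ring_hom ?h" by (rule id.comm_ring_hom_meval)
  have M': "?h (M i j) = A i j" for i j by (simp add: M v)
  have minor: "?h (minor M t f g) = minor A t f g" for t f g
    unfolding comm_ring_hom.hom_minor[OF h] M' ..
  show ?thesis
    by (rule that[OF h minor M']) (auto elim!: gensE simp: minor intro: minor_in_gens)
qed

text \<open>Rank conditions on \<open>s\<close> full columns of height \<open>k\<close> and the top \<open>p\<close> entries of the next column.\<close>

definition ladder :: "(nat \<Rightarrow> nat) \<Rightarrow> nat \<Rightarrow> nat \<Rightarrow> nat \<Rightarrow> ('x, 'a) mpoly set" where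
  "ladder \<tau> k s p = (\<Union>i\<in>{..k}. gens M (\<tau> i) {..<i} {..<if i \<le> p then Suc s else s})"

lemma ladder_subsetI:
  "(\<And>i. i \<le> k \<Longrightarrow> gens M (\<tau> i) {..<i} {..<if i \<le> p then Suc s else s} \<subseteq> T) \<Longrightarrow> ladder \<tau> k s p \<subseteq> T"
  by (auto simp: ladder_def)

lemma gens_subset_ladder:
  "i \<le> k \<Longrightarrow> c \<le> (if i \<le> p then Suc s else s) \<Longrightarrow> gens M (\<tau> i) {..<i} {..<c} \<subseteq> ladder \<tau> k s p"
  unfolding ladder_def by (rule order.trans[OF gens_mono UN_upper[of i]]) auto

lemma ladder_mono: "p \<le> p' \<Longrightarrow> ladder \<tau> k s p \<subseteq> ladder \<tau> k s p'"
  by (intro ladder_subsetI gens_subset_ladder) auto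

text \<open>Since the profile is flat at \<open>p\<close>, filling the next box \<open>y\<close>
  imposes a genuine condition: rank at most \<open>m\<close> on \<open>p + 1\<close> rows and
  \<open>s + 1\<close> columns. Modulo the old conditions the pivot minor \<open>q\<close> condenses
  it into \<open>q * y = r\<close>, the situation of \<open>prime_like_extend\<close>.\<close>

lemma prime_ladder_step:
  assumes \<tau>: "rank_profile \<tau>" and p: "Suc p \<le> k" and flat: "\<tau> p = Suc m" "\<tau> (Suc p) = Suc m" and m: "m \<le> s"
    and IH: "\<And>p' \<tau>. p' \<le> p \<Longrightarrow> rank_profile \<tau> \<Longrightarrow> prime_like (idl (ladder \<tau> k s p'))"
  shows "prime_like (idl (ladder \<tau> k s (Suc p)))"
proof -
  \<comment> \<open>The rank bound rises from \<open>u\<close> to \<open>u + 1\<close> when row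
    \<open>f u\<close>, counted from 0, is included. These rows carry the pivots.\<close>
  have "\<forall>u. \<exists>i. u < m \<longrightarrow> i < p \<and> \<tau> i = u + 1 \<and> \<tau> (Suc i) = u + 2"
  proof
    fix u
    have "u + 2 \<le> \<tau> p" if "u < m" using flat that by simp
    then show "\<exists>i. u < m \<longrightarrow> i < p \<and> \<tau> i = u + 1 \<and> \<tau> (Suc i) = u + 2"
      using rank_profile_jump[OF \<tau>] by blast
  qed
  from choice[OF this]
  obtain f where jump: "\<forall>u. u < m \<longrightarrow> f u < p \<and> \<tau> (f u) = u + 1 \<and> \<tau> (Suc (f u)) = u + 2" ..
  have f: "f u < p" "\<tau> (f u) = u + 1" "\<tau> (Suc (f u)) = u + 2" if "u < m" for u
    using jump that by metis+
  have f_inj: "inj_on f {..<m}"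
  proof (rule inj_onI)
    fix u v assume "u \<in> {..<m}" "v \<in> {..<m}" and eq: "f u = f v"
    then have "u < m" "v < m" by auto
    then have "u + 1 = v + 1" using f(2)[of u] f(2)[of v] eq by metis
    then show "u = v" by simp
  qed
  have f_less: "u + 2 \<le> \<tau> i" if "u < m" "f u < i" for u i
    using rank_profile_mono[OF \<tau>, of "Suc (f u)" i] f(3)[OF that(1)] that(2) by linarith
  have \<tau>_pos: "1 \<le> \<tau> i" for i
    using rank_profile_mono[OF \<tau>, of 0 i] \<tau> by (simp add: rank_profile_def)
  define y where "y = \<xi> p s"
  define q where "q = minor M m f id"
  define cof where "cof j b = border_cof M m f id j b" for j b
  \<comment> \<open>Chosen such that the minor bordering \<open>q\<close> at the new box is
    \<open>y * q - r\<close>.\<close>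
  define r where "r = - (\<Sum>j<m. M p j * cof j s)"
  define N where "N = ladder \<tau> k s p"
  \<comment> \<open>Up to sign, the added minors are the cofactors of \<open>y\<close> in the new
    generators.\<close>
  define C where "C = N \<union> gens M m {..<p} {..<s}"
  have free: "M i j \<in> var_free y" if "i \<noteq> p \<or> j \<noteq> s" for i j
    using that by (auto simp: M y_def dest: inj intro!: var_free_indet)
  have border: "minor M (Suc m) (f(m := i)) (id(m := j)) = M i j * q + (\<Sum>c<m. M i c * cof c j)" for i j
    unfolding minor_border q_def cof_def by simp
  have N_prime: "prime_like (idl N)"
    unfolding N_def by (rule IH) (use \<tau> in auto)
  have q_C: "q \<in> C"
    unfolding q_def C_def by (rule UnI2, rule minor_in_gens) (use f m in auto)

  have q_N: "q \<notin> idl N"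
  proof -
    \<comment> \<open>Ones at the positions \<open>(f u, u)\<close>: at most
      \<open>\<tau> i - 1\<close> pivot rows lie among the first \<open>i\<close> rows, so all rank
      conditions hold, while \<open>q\<close> becomes 1.\<close>
    obtain h :: "('x, 'a) mpoly \<Rightarrow> 'a" where h: "comm_ring_hom h"
      "\<And>t g g'. h (minor M t g g') = minor (match_mat m f id) t g g'"
      "\<And>t B C z. z \<in> gens M t B C \<Longrightarrow> h z \<in> gens (match_mat m f id) t B C"
      using ex_specialization[of "match_mat m f id"] by metis
    show ?thesis
    proof (rule notin_idl_if_hom[OF h(1)])
      show "h q \<noteq> 0"
        using minor_match_mat[of f m id, where 'a = 'a] f_inj by (simp add: q_def h(2))
      fix z assume "z \<in> N"
      then obtain i where z: "z \<in> gens M (\<tau> i) {..<i} {..<if i \<le> p then Suc s else s}"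
        by (auto simp: N_def ladder_def)
      show "h z = 0"
      proof (rule minor_match_mat_zero[OF _ h(3)[OF z]])
        have "card {u. u < m \<and> f u \<in> {..<i} \<and> id u \<in> {..<if i \<le> p then Suc s else s}} \<le> card {..<\<tau> i - 1}"
          by (intro card_mono) (auto dest: f_less)
        then show "card {u. u < m \<and> f u \<in> {..<i} \<and> id u \<in> {..<if i \<le> p then Suc s else s}} < \<tau> i"
          using \<tau>_pos[of i] by simp
      qed
    qed
  qed

  have r_C: "c \<in> idl C" if "r * c \<in> idl C" for c
  proof (cases m)
    case 0
    then have "1 \<in> C" using q_C by (simp add: q_def)
    then show ?thesis using idl.span_scale[OF idl.span_base, of 1 C c] by simp
  next
    case (Suc m')
    \<comment> \<open>Capping the profile at \<open>m\<close> on the first \<open>p\<close> rows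
      moves its last jump there from row \<open>p'\<close> to row \<open>p\<close>. In between, the
      conditions reaching column \<open>s\<close> follow by expansion from the
      \<open>m\<close>-minors of the first \<open>s\<close> columns, so the partial column can be
      cut back to height \<open>p'\<close>.\<close>
    define p' where "p' = f m'"
    define \<tau>' where "\<tau>' i = (if i \<le> p then min (\<tau> i) m else \<tau> i)" for i
    have p': "p' < p" "\<tau> p' = m" "\<tau> (Suc p') = Suc m"
      using f[of m'] Suc by (auto simp: p'_def)
    have low: "\<tau> i \<le> m" if "i \<le> p'" for i
      using rank_profile_mono[OF \<tau> that] p' by simp
    have high: "\<tau> i = Suc m" if "p' < i" "i \<le> p" for i
      using rank_profile_mono[OF \<tau>, of "Suc p'" i] rank_profile_mono[OF \<tau>, of i p] p' that flat by simp
    have \<tau>': "rank_profile \<tau>'"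
      unfolding rank_profile_def
    proof (intro conjI allI)
      show "\<tau>' 0 = 1" using \<tau> Suc by (simp add: \<tau>'_def rank_profile_def)
      fix i
      have "\<tau> i \<le> \<tau> (Suc i)" "\<tau> (Suc i) \<le> Suc (\<tau> i)" using \<tau> by (auto simp: rank_profile_def)
      then show "\<tau>' i \<le> \<tau>' (Suc i)" "\<tau>' (Suc i) \<le> Suc (\<tau>' i)"
        using flat by (cases "i = p"; auto simp: \<tau>'_def)+
    qed
    have C_eq: "idl C = idl (ladder \<tau>' k s p')"
    proof (rule idl_eqI)
      have sub: "gens M m {..<i} {..<s} \<subseteq> idl (ladder \<tau>' k s p')" if "p' < i" "i \<le> p" for i
      proof -
        have "\<tau>' i = m" using high[OF that] that by (simp add: \<tau>'_def)
        then show ?thesis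
          using gens_subset_ladder[of i k s p' s \<tau>'] that p idl.span_superset by (auto simp: subset_iff)
      qed
      have "N \<subseteq> idl (ladder \<tau>' k s p')"
        unfolding N_def
      proof (rule ladder_subsetI)
        fix i assume i: "i \<le> k"
        consider "i \<le> p'" | "p' < i" "i \<le> p" | "p < i" by linarith
        then show "gens M (\<tau> i) {..<i} {..<if i \<le> p then Suc s else s} \<subseteq> idl (ladder \<tau>' k s p')"
        proof cases
          case 1
          then have "\<tau>' i = \<tau> i" using low by (auto simp: \<tau>'_def)
          then show ?thesis
            using gens_subset_ladder[of i k "if i \<le> p then Suc s else s" p' s \<tau>'] i 1 p'
            by (auto intro!: idl.span_base)
        next
          case 2
          then show ?thesis
            using gens_insert_col[OF sub[OF 2], of s] high by (simp add: lessThan_Suc)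
        next
          case 3
          then have "\<tau>' i = \<tau> i" by (auto simp: \<tau>'_def)
          then show ?thesis
            using gens_subset_ladder[of i k "if i \<le> p then Suc s else s" p' s \<tau>'] i 3 p'
            by (auto intro!: idl.span_base)
        qed
      qed
      moreover have "gens M m {..<p} {..<s} \<subseteq> idl (ladder \<tau>' k s p')"
        by (rule sub) (use p' in auto)
      ultimately show "C \<subseteq> idl (ladder \<tau>' k s p')" by (simp add: C_def)
      show "ladder \<tau>' k s p' \<subseteq> idl C"
      proof (rule ladder_subsetI)
        fix i assume i: "i \<le> k"
        consider "i \<le> p'" | "p' < i" "i \<le> p" | "p < i" by linarith
        then have "gens M (\<tau>' i) {..<i} {..<if i \<le> p' then Suc s else s} \<subseteq> C"
        proof cases
          case 1
          then have "\<tau>' i = \<tau> i" using low by (auto simp: \<tau>'_def)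
          then show ?thesis
            using gens_subset_ladder[of i k "if i \<le> p' then Suc s else s" p s \<tau>] i 1 p'
            by (auto simp: C_def N_def)
        next
          case 2
          then have "\<tau>' i = m" using high by (simp add: \<tau>'_def)
          then show ?thesis
            using gens_mono[of "{..<i}" "{..<p}" "{..<s}" "{..<s}" M m] 2 by (auto simp: C_def)
        next
          case 3
          then have "\<tau>' i = \<tau> i" by (auto simp: \<tau>'_def)
          then show ?thesis
            using gens_subset_ladder[of i k "if i \<le> p' then Suc s else s" p s \<tau>] i 3 p'
            by (auto simp: C_def N_def)
        qed
        then show "gens M (\<tau>' i) {..<i} {..<if i \<le> p' then Suc s else s} \<subseteq> idl C"
          using idl.span_superset by blast
      qed
    qed
    have C_prime: "prime_like (idl C)"
      unfolding C_eq by (rule IH) (use p' \<tau>' in auto)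
    have "r \<notin> idl C"
    proof -
      \<comment> \<open>Ones at \<open>(f u, u)\<close> for \<open>u < m'\<close>, at
        \<open>(f m', s)\<close> and at \<open>(p, m')\<close>. Exchanging the last two columns puts
        0 into the new box, so that \<open>- r\<close> specialises to the bordered minor, which is 1
        or -1. Below row \<open>p'\<close> the one in column \<open>s\<close> falls outside the
        \<open>s\<close> columns that are counted.\<close>
      define f2 where "f2 = f(m := p)"
      define g1 where "g1 = (id(m := s) :: nat \<Rightarrow> nat)"
      define \<pi> where "\<pi> = Transposition.transpose m' m"
      define g2 where "g2 = g1 \<circ> \<pi>"
      have g2: "g2 m' = s" "g2 m = m'" "\<And>u. u < m' \<Longrightarrow> g2 u = u"
        by (auto simp: g2_def g1_def \<pi>_def Suc Transposition.transpose_def)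
      have perm: "\<pi> permutes {0..<Suc m}"
        unfolding \<pi>_def by (rule permutes_swap_id) (auto simp: Suc)
      have "f u \<noteq> p" if "u < m" for u
        using f(1)[OF that] by simp
      then have f2_inj: "inj_on f2 {..<Suc m}"
        unfolding f2_def by (intro inj_on_upd_lessThan_Suc f_inj) blast
      have "inj_on g1 {..<Suc m}"
        using m by (auto simp: g1_def inj_on_def)
      then have g2_inj: "inj_on g2 {..<Suc m}"
        unfolding g2_def using perm
        by (intro comp_inj_on) (auto simp: permutes_inj_on permutes_image lessThan_atLeast0)
      obtain h :: "('x, 'a) mpoly \<Rightarrow> 'a" where h: "comm_ring_hom h"
        "\<And>t g g'. h (minor M t g g') = minor (match_mat (Suc m) f2 g2) t g g'"
        "\<And>i j. h (M i j) = match_mat (Suc m) f2 g2 i j"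
        "\<And>t B C z. z \<in> gens M t B C \<Longrightarrow> h z \<in> gens (match_mat (Suc m) f2 g2) t B C"
        using ex_specialization[of "match_mat (Suc m) f2 g2"] by metis
      interpret h: comm_ring_hom h by fact
      have "minor (match_mat (Suc m) f2 g2 :: nat \<Rightarrow> nat \<Rightarrow> 'a) (Suc m) f2 g2 = 1"
        by (rule minor_match_mat[OF f2_inj g2_inj])
      then have "h (minor M (Suc m) f2 g1) \<noteq> 0"
        unfolding h(2) using minor_permute_col[OF perm, of "match_mat (Suc m) f2 g2 :: nat \<Rightarrow> nat \<Rightarrow> 'a" f2 g1]
        by (auto simp: g2_def)
      moreover have "h (M p s) = 0"
      proof -
        have "\<not> (p = f2 u \<and> s = g2 u)" if "u < Suc m" for u
          using that f(1)[of u] g2 m Suc by (cases "u = m") (auto simp: f2_def)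
        then show ?thesis by (simp add: h(3) match_mat_def)
      qed
      moreover have "minor M (Suc m) f2 g1 = M p s * q - r"
        unfolding f2_def g1_def border r_def by simp
      ultimately have hr: "h r \<noteq> 0" by (auto simp: h.hom_minus h.hom_mult)
      show ?thesis
        unfolding C_eq
      proof (rule notin_idl_if_hom[OF h(1) _ hr])
        fix z assume "z \<in> ladder \<tau>' k s p'"
        then obtain i where z: "z \<in> gens M (\<tau>' i) {..<i} {..<if i \<le> p' then Suc s else s}"
          by (auto simp: ladder_def)
        let ?U = "{u. u < Suc m \<and> f2 u \<in> {..<i} \<and> g2 u \<in> {..<if i \<le> p' then Suc s else s}}"
        show "h z = 0"
        proof (rule minor_match_mat_zero[OF _ h(4)[OF z]])
          consider "i \<le> p'" | "p' < i" "i \<le> p" | "p < i" by linarith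
          then show "card ?U < \<tau>' i"
          proof cases
            case 1
            have "?U \<subseteq> {..<\<tau> i - 1}"
            proof
              fix u assume u: "u \<in> ?U"
              then have "u \<noteq> m" using 1 p' by (auto simp: f2_def)
              then show "u \<in> {..<\<tau> i - 1}"
                using u f_less[of u i] by (auto simp: f2_def)
            qed
            then have "card ?U \<le> card {..<\<tau> i - 1}" by (intro card_mono) auto
            moreover have "\<tau>' i = \<tau> i" using low[OF 1] by (auto simp: \<tau>'_def)
            ultimately show ?thesis using \<tau>_pos[of i] by simp
          next
            case 2
            have "?U \<subseteq> {..<m'}"
            proof
              fix u assume u: "u \<in> ?U"
              then have "u \<noteq> m" "u \<noteq> m'" using 2 g2 by (auto simp: f2_def)
              then show "u \<in> {..<m'}" using u Suc by auto
            qed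
            then have "card ?U \<le> card {..<m'}" by (intro card_mono) auto
            moreover have "\<tau>' i = m" using high[OF 2] 2 by (auto simp: \<tau>'_def)
            ultimately show ?thesis using Suc by simp
          next
            case 3
            have "m' \<notin> ?U" using 3 p' g2 by auto
            then have "?U \<subseteq> {..<Suc m} - {m'}" by auto
            then have "card ?U \<le> card ({..<Suc m} - {m'})" by (intro card_mono) auto
            moreover have "\<tau>' i = \<tau> i" "Suc m \<le> \<tau> i"
              using rank_profile_mono[OF \<tau>, of "Suc p" i] flat 3 by (auto simp: \<tau>'_def)
            ultimately show ?thesis using Suc by simp
          qed
        qed
      qed
    qed
    then show ?thesis using prime_likeD[OF C_prime that] by blast
  qed

  have corner: "degree (split_var y F) \<le> Suc m \<and> hev q r (Suc m) (split_var y F) \<in> idl N"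
    if F: "F \<in> gens M (Suc m) {..<Suc p} {..<Suc s}" for F
    using F
  proof (rule gensE)
    fix f' g' assume F: "F = minor M (Suc m) f' g'" and f': "f' ` {..<Suc m} \<subseteq> {..<Suc p}"
      and g': "g' ` {..<Suc m} \<subseteq> {..<Suc s}"
    \<comment> \<open>Homogenising at \<open>r / q\<close> turns the new box into \<open>r\<close>,
      which is \<open>?W p s\<close>. Elsewhere the difference to \<open>?W\<close> is a minor
      bordering \<open>q\<close> that avoids the box: in row \<open>p\<close> it falls under the
      bound on \<open>p + 1\<close> rows and \<open>s\<close> columns, otherwise under the one on
      \<open>p\<close> rows and \<open>s + 1\<close> columns.\<close>
    let ?W = "\<lambda>i j. \<Sum>c<m. M i c * (- cof c j)"
    have split: "split_var y F = minor (\<lambda>i j. split_var y (M i j)) (Suc m) f' g'"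
      unfolding F split_var.hom_minor ..
    have deg: "degree (split_var y (M i j)) \<le> 1" for i j
      by (simp add: M split_var_indet)
    have "hev q r (Suc m) (split_var y F) = minor (\<lambda>i j. hev q r 1 (split_var y (M i j))) (Suc m) f' g'"
      unfolding split by (rule hev_minor) (rule deg)
    also have "\<dots> = \<dots> - minor ?W (Suc m) f' g'"
      unfolding minor_factor_zero[where U = M] by simp
    also have "\<dots> \<in> idl N"
    proof (rule minor_diff_mem_idl)
      fix a b assume "a < Suc m" "b < Suc m"
      then have ab: "f' a \<le> p" "g' b \<le> s" using f' g' by (auto simp: image_subset_iff less_Suc_eq_le)
      show "hev q r 1 (split_var y (M (f' a) (g' b))) - ?W (f' a) (g' b) \<in> idl N"
      proof (cases "f' a = p \<and> g' b = s")
        case True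
        then have "split_var y (M (f' a) (g' b)) = [:0, 1:]" by (simp add: M y_def split_var_indet)
        then show ?thesis
          using True by (simp add: hev_linear r_def sum_negf idl.span_zero)
      next
        case False
        then have "split_var y (M (f' a) (g' b)) = [:M (f' a) (g' b):]"
          using free by (auto simp: var_free_def)
        then have "hev q r 1 (split_var y (M (f' a) (g' b))) - ?W (f' a) (g' b) =
            minor M (Suc m) (f(m := f' a)) (id(m := g' b))"
          unfolding border by (simp add: sum_negf)
        also have "\<dots> \<in> N"
        proof (cases "f' a = p")
          case True
          have "minor M (Suc m) (f(m := f' a)) (id(m := g' b)) \<in> gens M (\<tau> (Suc p)) {..<Suc p} {..<s}"
            unfolding flat
            by (rule minor_in_gens) (use f(1) ab m False True in \<open>auto simp: less_Suc_eq\<close>)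
          then show ?thesis
            using gens_subset_ladder[of "Suc p" k s p s \<tau>] p by (auto simp: N_def)
        next
          case False
          have "minor M (Suc m) (f(m := f' a)) (id(m := g' b)) \<in> gens M (\<tau> p) {..<p} {..<Suc s}"
            unfolding flat
            by (rule minor_in_gens) (use f(1) ab m False in \<open>auto simp: less_Suc_eq\<close>)
          then show ?thesis
            using gens_subset_ladder[of p k "Suc s" p s \<tau>] p by (auto simp: N_def)
        qed
        finally show ?thesis by (rule idl.span_base)
      qed
    qed
    finally show ?thesis
      using degree_minor_le[of "Suc m" "\<lambda>i j. split_var y (M i j)" f' g'] deg split by simp
  qed

  show ?thesis
  proof (rule prime_like_extend[where y = y and N = N and C = C and q = q and r = r])
    show "prime_like (idl N)" by (rule N_prime)
    have "N \<subseteq> ladder \<tau> k s (Suc p)" unfolding N_def by (rule ladder_mono) simp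
    then show N_I: "idl N \<subseteq> idl (ladder \<tau> k s (Suc p))" by (rule idl.span_mono)
    show "idl N \<subseteq> idl C" by (rule idl.span_mono) (simp add: C_def)
    show "q \<in> idl C" using q_C by (rule idl.span_base)
    show "q \<notin> idl N" by (rule q_N)
    show "c \<in> idl C" if "r * c \<in> idl C" for c using that by (rule r_C)
    show "\<exists>d. c * indet y + d \<in> idl (ladder \<tau> k s (Suc p)) \<and> hev q r 1 [:d, c:] \<in> idl N" if "c \<in> C" for c
    proof (cases "c \<in> N")
      case True
      then have "c * indet y \<in> idl N" "hev q r 1 [:0, c:] \<in> idl N"
        by (simp_all add: hev_linear idl.span_base idl_mult_right)
      then show ?thesis using N_I by (intro exI[of _ 0]) auto
    next
      case False
      then have "c \<in> gens M m {..<p} {..<s}" using that by (simp add: C_def)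
      then show ?thesis
      proof (rule gensE)
        fix f' g' assume c: "c = minor M m f' g'" and f': "f' ` {..<m} \<subseteq> {..<p}" and g': "g' ` {..<m} \<subseteq> {..<s}"
        \<comment> \<open>Bordering the cofactor \<open>c\<close> by row \<open>p\<close> and column
          \<open>s\<close> gives a new generator, linear in \<open>y\<close> with leading
          coefficient \<open>c\<close>.\<close>
        define d where "d = (\<Sum>j<m. M p (g' j) * border_cof M m f' g' j s)"
        have d: "c * indet y + d = minor M (Suc m) (f'(m := p)) (g'(m := s))"
          unfolding minor_border d_def c by (simp add: M y_def mult.commute)
        have gens: "c * indet y + d \<in> gens M (Suc m) {..<Suc p} {..<Suc s}"
          unfolding d by (rule minor_in_gens) (use f' g' in \<open>auto simp: image_subset_iff less_Suc_eq\<close>)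
        have "c \<in> var_free y"
          unfolding c by (rule var_free_minor, rule free) (use f' in auto)
        moreover have "d \<in> var_free y"
          unfolding d_def
          by (intro var_free_sum var_free_mult var_free_border_cof free) (use f' g' in auto)
        ultimately have split: "split_var y (c * indet y + d) = [:d, c:]"
          by (simp add: split_var.hom_add split_var.hom_mult split_var_indet var_free_def)
        have "hev q r (Suc m) [:d, c:] \<in> idl N"
          using corner[OF gens] unfolding split by simp
        then have "q ^ m * hev q r 1 [:d, c:] \<in> idl N"
          using hev_raise_add[of "[:d, c:]" 1 q r m] by simp
        then have "hev q r 1 [:d, c:] \<in> idl N"
          using prime_like_power_mult[OF N_prime] q_N by blast
        moreover have "c * indet y + d \<in> idl (ladder \<tau> k s (Suc p))"
          using gens_subset_ladder[of "Suc p" k "Suc s" "Suc p" s \<tau>] gens p flat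
          by (intro idl.span_base) auto
        ultimately show ?thesis by blast
      qed
    qed
    fix F assume "F \<in> ladder \<tau> k s (Suc p)"
    then obtain i where i: "i \<le> k" "F \<in> gens M (\<tau> i) {..<i} {..<if i \<le> Suc p then Suc s else s}"
      by (auto simp: ladder_def)
    show "\<exists>n. degree (split_var y F) \<le> n \<and> hev q r n (split_var y F) \<in> idl N"
    proof (cases "i = Suc p")
      case True
      then show ?thesis using corner[of F] i flat by (auto intro!: exI[of _ "Suc m"])
    next
      case False
      then have eq: "(if i \<le> Suc p then Suc s else s) = (if i \<le> p then Suc s else s)" by simp
      have "F \<in> N" using i unfolding eq N_def ladder_def by (intro UN_I[of i]) auto
      moreover have "F \<in> var_free y"
        using i(2) unfolding eq
      proof (rule gensE)
        fix f' g' assume F: "F = minor M (\<tau> i) f' g'" and f': "f' ` {..<\<tau> i} \<subseteq> {..<i}"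
          and g': "g' ` {..<\<tau> i} \<subseteq> {..<if i \<le> p then Suc s else s}"
        show ?thesis
          unfolding F
        proof (rule var_free_minor, rule free)
          fix a b assume "a < \<tau> i" "b < \<tau> i"
          then have "f' a < i" "g' b < (if i \<le> p then Suc s else s)" using f' g' by blast+
          then show "f' a \<noteq> p \<or> g' b \<noteq> s" by (cases "i \<le> p") auto
        qed
      qed
      ultimately show ?thesis
        by (intro exI[of _ 0]) (simp add: var_free_def idl.span_base)
    qed
  qed
qed

text \<open>Two kinds of boxes add nothing: if the profile jumps, the larger minors expand along the
  new row, and if there are too few columns they vanish. A flat profile needs the extension step,
  whose \<open>C\<close> has smaller height but another profile; hence the induction ranges over all
  profiles.\<close>

lemma prime_ladder_column:
  assumes base: "\<And>\<tau>. rank_profile \<tau> \<Longrightarrow> prime_like (idl (ladder \<tau> k s 0))"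
    and "rank_profile \<tau>" "p \<le> k"
  shows "prime_like (idl (ladder \<tau> k s p))"
  using assms(2,3)
proof (induction p arbitrary: \<tau> rule: less_induct)
  case (less p)
  show ?case
  proof (cases p)
    case 0
    then show ?thesis using base less by simp
  next
    case (Suc p')
    have IH: "prime_like (idl (ladder \<tau>' k s p''))" if "p'' \<le> p'" "rank_profile \<tau>'" for p'' \<tau>'
      using less.IH[of p'' \<tau>'] less.prems that Suc by simp
    have pos: "0 < \<tau> p'"
      using rank_profile_mono[OF less.prems(1), of 0 p'] less.prems by (simp add: rank_profile_def)
    have unchanged: ?thesis if "gens M (\<tau> p) {..<p} {..<Suc s} \<subseteq> idl (ladder \<tau> k s p')"
    proof -
      have "ladder \<tau> k s p \<subseteq> idl (ladder \<tau> k s p')"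
      proof (rule ladder_subsetI)
        fix i assume i: "i \<le> k"
        show "gens M (\<tau> i) {..<i} {..<if i \<le> p then Suc s else s} \<subseteq> idl (ladder \<tau> k s p')"
        proof (cases "i = p")
          case False
          then have eq: "(if i \<le> p then Suc s else s) = (if i \<le> p' then Suc s else s)" using Suc by simp
          show ?thesis
            unfolding eq
            using gens_subset_ladder[of i k "if i \<le> p' then Suc s else s" p' s \<tau>] i idl.span_superset by blast
        qed (use that in simp)
      qed
      moreover have "ladder \<tau> k s p' \<subseteq> idl (ladder \<tau> k s p)"
        using ladder_mono[of p' p \<tau> k s] Suc idl.span_superset by fastforce
      ultimately have "idl (ladder \<tau> k s p) = idl (ladder \<tau> k s p')"
        by (rule idl_eqI)
      then show ?thesis using IH[of p' \<tau>] less.prems by simp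
    qed
    consider "\<tau> p = Suc (\<tau> p')" | "\<tau> p = \<tau> p'" "Suc s < \<tau> p" | "\<tau> p = \<tau> p'" "\<tau> p \<le> Suc s"
      using less.prems(1) unfolding rank_profile_def Suc by (metis le_SucE le_antisym not_less)
    then show ?thesis
    proof cases
      case 1
      have "gens M (\<tau> p') {..<p'} {..<Suc s} \<subseteq> idl (ladder \<tau> k s p')"
        using gens_subset_ladder[of p' k "Suc s" p' s \<tau>] less.prems Suc idl.span_superset by fastforce
      from gens_insert_row[OF this, of p'] show ?thesis
        using unchanged 1 Suc by (simp add: lessThan_Suc)
    next
      case 2
      then show ?thesis
        by (intro unchanged idl_subset_zero gens_subset_zero_col) auto
    next
      case 3
      show ?thesis
        using prime_ladder_step[of \<tau> p' k "\<tau> p' - 1" s] 3 less.prems pos IH Suc by simp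
    qed
  qed
qed

text \<open>A partial column of height \<open>k\<close> is one more full column. At height 0 the
  wider range is granted to \<open>i = 0\<close> alone, a condition on no rows.\<close>

lemma prime_ladder:
  assumes "rank_profile \<tau>"
  shows "prime_like (idl (ladder \<tau> k s 0))"
  using assms
proof (induction s arbitrary: \<tau>)
  case 0
  have "0 < \<tau> i" for i
    using rank_profile_mono[OF 0, of 0 i] 0 by (simp add: rank_profile_def)
  then have "gens M (\<tau> i) {..<i} {..<if i \<le> 0 then Suc 0 else 0} \<subseteq> {0}" for i
    by (cases "i = 0") (rule gens_subset_zero gens_subset_zero_col; simp)+
  then have "ladder \<tau> k 0 0 \<subseteq> {0}"
    by (intro ladder_subsetI)
  then have "idl (ladder \<tau> k 0 0) = idl {}"
    by (intro idl_eqI idl_subset_zero) auto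
  then show ?case by (simp add: prime_like_def)
next
  case (Suc s)
  have "idl (ladder \<tau> k (Suc s) 0) = idl (ladder \<tau> k s k)"
  proof (rule idl_eqI)
    show "ladder \<tau> k (Suc s) 0 \<subseteq> idl (ladder \<tau> k s k)"
    proof (rule ladder_subsetI)
      fix i assume i: "i \<le> k"
      show "gens M (\<tau> i) {..<i} {..<if i \<le> 0 then Suc (Suc s) else Suc s} \<subseteq> idl (ladder \<tau> k s k)"
      proof (cases "i = 0")
        case True
        then show ?thesis
          using Suc.prems by (intro idl_subset_zero gens_subset_zero) (auto simp: rank_profile_def)
      next
        case False
        then show ?thesis
          using gens_subset_ladder[of i k "Suc s" k s \<tau>] i idl.span_superset by fastforce
      qed
    qed
    have "ladder \<tau> k s k \<subseteq> ladder \<tau> k (Suc s) 0"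
      by (intro ladder_subsetI gens_subset_ladder) auto
    then show "ladder \<tau> k s k \<subseteq> idl (ladder \<tau> k (Suc s) 0)"
      using idl.span_superset by blast
  qed
  then show ?case
    using prime_ladder_column[of k s \<tau> k] Suc by simp
qed

lemma prime_gens_initial:
  assumes "1 \<le> t"
  shows "prime_like (idl (gens M t {..<r} {..<s}))"
proof -
  \<comment> \<open>On fewer than \<open>t\<close> rows the minor size \<open>i + 1\<close> exceeds
    the number of rows, so the condition is void.\<close>
  define \<tau> where "\<tau> i = min (Suc i) t" for i
  have "idl (gens M t {..<r} {..<s}) = idl (ladder \<tau> r s 0)"
  proof (rule idl_eqI)
    show "gens M t {..<r} {..<s} \<subseteq> idl (ladder \<tau> r s 0)"
    proof (cases "r < t")
      case True
      then show ?thesis by (intro idl_subset_zero gens_subset_zero) auto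
    next
      case False
      then show ?thesis
        using gens_subset_ladder[of r r s 0 s \<tau>] idl.span_superset by (fastforce simp: \<tau>_def min_def split: if_splits)
    qed
    show "ladder \<tau> r s 0 \<subseteq> idl (gens M t {..<r} {..<s})"
    proof (rule ladder_subsetI)
      fix i assume i: "i \<le> r"
      show "gens M (\<tau> i) {..<i} {..<if i \<le> 0 then Suc s else s} \<subseteq> idl (gens M t {..<r} {..<s})"
      proof (cases "i < t")
        case True
        then show ?thesis by (intro idl_subset_zero gens_subset_zero) (auto simp: \<tau>_def)
      next
        case False
        then have "gens M (\<tau> i) {..<i} {..<if i \<le> 0 then Suc s else s} \<subseteq> gens M t {..<r} {..<s}"
          using assms i gens_mono[of "{..<i}" "{..<r}" "{..<s}" "{..<s}" M t] by (auto simp: \<tau>_def min_def)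
        then show ?thesis using idl.span_superset by blast
      qed
    qed
  qed
  moreover have "rank_profile \<tau>"
    using assms by (auto simp: rank_profile_def \<tau>_def)
  ultimately show ?thesis using prime_ladder by simp
qed

end

section \<open>Primality for arbitrary row and column sets\<close>

lemma ex_inj_enumeration:
  assumes "finite (A :: nat set)"
  obtains \<alpha> :: "nat \<Rightarrow> nat" where "inj \<alpha>" "\<alpha> ` {..<card A} = A"
proof -
  obtain h where h: "bij_betw h {..<card A} A"
    using ex_bij_betw_nat_finite[OF assms] by (auto simp: atLeast0LessThan)
  \<comment> \<open>Continued past the maximum of \<open>A\<close> to be injective on all numbers,
    so that a reindexed matrix is again an instance of \<open>generic_entries\<close>.\<close>
  define \<alpha> where "\<alpha> i = (if i < card A then h i else Suc (i + Max (insert 0 A)))" for i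
  have le: "h i \<le> Max (insert 0 A)" if "i < card A" for i
    using bij_betwE[OF h] that assms by (intro Max_ge) auto
  have inj_h: "h i = h j \<Longrightarrow> i < card A \<Longrightarrow> j < card A \<Longrightarrow> i = j" for i j
    using bij_betw_imp_inj_on[OF h] by (auto dest: inj_onD)
  show ?thesis
  proof (rule that)
    show "inj \<alpha>"
    proof (rule injI)
      fix i j assume "\<alpha> i = \<alpha> j"
      then show "i = j"
        using inj_h[of i j] le[of i] le[of j] by (auto simp: \<alpha>_def split: if_splits)
    qed
    have "\<alpha> ` {..<card A} = h ` {..<card A}"
      by (auto simp: \<alpha>_def)
    then show "\<alpha> ` {..<card A} = A"
      using bij_betw_imp_surj_on[OF h] by simp
  qed
qed

lemma gens_reindex:
  "gens (\<lambda>i j. M (\<alpha> i) (\<beta> j)) t A B = gens M t (\<alpha> ` A) (\<beta> ` B)"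
proof (intro equalityI subsetI)
  fix F assume "F \<in> gens (\<lambda>i j. M (\<alpha> i) (\<beta> j)) t A B"
  then obtain f g where F: "F = minor (\<lambda>i j. M (\<alpha> i) (\<beta> j)) t f g" and fg: "f ` {..<t} \<subseteq> A" "g ` {..<t} \<subseteq> B"
    by (rule gensE)
  have "F = minor M t (\<alpha> \<circ> f) (\<beta> \<circ> g)" unfolding F by (rule minor_cong) simp
  then show "F \<in> gens M t (\<alpha> ` A) (\<beta> ` B)"
    using fg by (auto intro!: minor_in_gens)
next
  fix F assume "F \<in> gens M t (\<alpha> ` A) (\<beta> ` B)"
  then obtain f g where F: "F = minor M t f g" and fg: "f ` {..<t} \<subseteq> \<alpha> ` A" "g ` {..<t} \<subseteq> \<beta> ` B"
    by (rule gensE)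
  let ?f = "inv_into A \<alpha> \<circ> f" and ?g = "inv_into B \<beta> \<circ> g"
  have "F = minor (\<lambda>i j. M (\<alpha> i) (\<beta> j)) t ?f ?g"
    unfolding F by (rule minor_cong) (use fg in \<open>auto simp: image_subset_iff f_inv_into_f\<close>)
  moreover have "?f ` {..<t} \<subseteq> A" "?g ` {..<t} \<subseteq> B"
    using fg by (auto simp: image_subset_iff inv_into_into)
  ultimately show "F \<in> gens (\<lambda>i j. M (\<alpha> i) (\<beta> j)) t A B"
    by (simp only: minor_in_gens)
qed

context generic_entries
begin

theorem prime_gens:
  assumes "finite A" "finite B" "1 \<le> t"
  shows "prime_like (idl (gens M t A B))"
proof -
  obtain \<alpha> where \<alpha>: "inj \<alpha>" "\<alpha> ` {..<card A} = A" using ex_inj_enumeration[OF assms(1)] .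
  obtain \<beta> where \<beta>: "inj \<beta>" "\<beta> ` {..<card B} = B" using ex_inj_enumeration[OF assms(2)] .
  interpret re: generic_entries "\<lambda>i j. \<xi> (\<alpha> i) (\<beta> j)" "\<lambda>i j. M (\<alpha> i) (\<beta> j)"
  proof
    fix i j i' j' assume "\<xi> (\<alpha> i) (\<beta> j) = \<xi> (\<alpha> i') (\<beta> j')"
    then have "\<alpha> i = \<alpha> i'" "\<beta> j = \<beta> j'" using inj by blast+
    then show "i = i' \<and> j = j'" using \<alpha>(1) \<beta>(1) by (auto dest: injD)
  qed (rule M)
  show ?thesis
    using re.prime_gens_initial[OF assms(3), of "card A" "card B"] unfolding gens_reindex \<alpha>(2) \<beta>(2) .
qed

section \<open>Elements for the colon ideals\<close>

lemma minor_notin_gens: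
  assumes "inj_on f {..<n}" "inj_on g {..<n}" "card {m. m < n \<and> f m \<in> A \<and> g m \<in> B} < t"
  shows "minor M n f g \<notin> idl (gens M t A B)"
proof -
  obtain h :: "('x, 'a) mpoly \<Rightarrow> 'a" where h: "comm_ring_hom h"
    "\<And>t f' g'. h (minor M t f' g') = minor (match_mat n f g) t f' g'"
    "\<And>t B C z. z \<in> gens M t B C \<Longrightarrow> h z \<in> gens (match_mat n f g) t B C"
    using ex_specialization[of "match_mat n f g"] by metis
  show ?thesis
  proof (rule notin_idl_if_hom[OF h(1)])
    show "h z = 0" if "z \<in> gens M t A B" for z
      using minor_match_mat_zero[OF assms(3) h(3)[OF that]] .
    show "h (minor M n f g) \<noteq> 0"
      unfolding h(2) using minor_match_mat[OF assms(1,2), where 'a = 'a] by simp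
  qed
qed

lemma minor_nonzero:
  assumes "inj_on f {..<n}" "inj_on g {..<n}"
  shows "minor M n f g \<noteq> 0"
proof
  assume "minor M n f g = 0"
  moreover have "minor M n f g \<notin> idl (gens M (Suc n) UNIV UNIV)"
    by (rule minor_notin_gens[OF assms]) simp
  ultimately show False by (simp add: idl.span_zero)
qed

text \<open>\<open>D\<close> avoids both \<open>b1\<close> and \<open>b2\<close>. A bordering minor
  adds one column, so it still misses one of the two and belongs to the sum.\<close>

lemma colon_two_columns:
  assumes "finite A" "finite B" "b1 \<noteq> b2" "m \<le> card A" "m \<le> card (B - {b1, b2})"
  obtains D n where "D \<in> gens M m A B"
    "\<And>h. D ^ n * h \<in> idl (gens M (Suc m) A B) \<Longrightarrow> h \<in> idl (gens M (Suc m) A B)"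
    "\<And>F. F \<in> gens M (Suc m) A B \<Longrightarrow>
      D ^ n * F \<in> idl (gens M (Suc m) A (B - {b1}) \<union> gens M (Suc m) A (B - {b2}))"
proof -
  let ?S = "gens M (Suc m) A (B - {b1}) \<union> gens M (Suc m) A (B - {b2})"
  obtain f where f: "inj f" "f ` {..<card A} = A" using ex_inj_enumeration[OF assms(1)] .
  obtain g where g: "inj g" "g ` {..<card (B - {b1, b2})} = B - {b1, b2}"
    using ex_inj_enumeration[of "B - {b1, b2}"] assms(2) by blast
  have fA: "f ` {..<m} \<subseteq> A" using f(2) assms(4) by (force simp: image_subset_iff)
  have gB: "g ` {..<m} \<subseteq> B - {b1, b2}"
  proof -
    have "g ` {..<m} \<subseteq> g ` {..<card (B - {b1, b2})}" using assms(5) by (intro image_mono) auto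
    then show ?thesis using g(2) by simp
  qed
  let ?D = "minor M m f g"
  have border: "minor M (Suc m) (f(m := a)) (g(m := b)) \<in> idl ?S" if "a \<in> A" "b \<in> B" for a b
  proof -
    have "(f(m := a)) ` {..<Suc m} \<subseteq> A"
      unfolding image_upd_lessThan_Suc using fA that by blast
    moreover have "(g(m := b)) ` {..<Suc m} \<subseteq> B - {b1} \<or> (g(m := b)) ` {..<Suc m} \<subseteq> B - {b2}"
      unfolding image_upd_lessThan_Suc using gB that assms(3) by blast
    ultimately have "minor M (Suc m) (f(m := a)) (g(m := b)) \<in> ?S"
      using minor_in_gens[of "f(m := a)" "Suc m" A "g(m := b)"] by blast
    then show ?thesis by (rule idl.span_base)
  qed
  show ?thesis
  proof (rule that[of ?D "Suc m"])
    show "?D \<in> gens M m A B" using fA gB by (intro minor_in_gens) auto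
    show "?D ^ Suc m * F \<in> idl ?S" if "F \<in> gens M (Suc m) A B" for F
      by (rule pivot_mult_minor[OF border that])
    have "card {u. u < m \<and> f u \<in> A \<and> g u \<in> B} \<le> card {..<m}" by (intro card_mono) auto
    then have "?D \<notin> idl (gens M (Suc m) A B)"
      by (intro minor_notin_gens inj_on_subset[OF f(1)] inj_on_subset[OF g(1)]) auto
    then show "h \<in> idl (gens M (Suc m) A B)" if "?D ^ Suc m * h \<in> idl (gens M (Suc m) A B)" for h
      using prime_like_power_mult[OF prime_gens that] assms by simp
  qed
qed

text \<open>\<open>Bo a\<close> is linear in its last column, and modulo the (m+2)-minors bordering
  \<open>D'\<close>, the product of \<open>D'\<close> with column \<open>b\<close> is a combination
  of the columns of \<open>D'\<close>. So \<open>D' * Bo a b\<close> reduces to the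
  \<open>Bo a (g c)\<close>, which are minors on \<open>B - {b}\<close>.\<close>

lemma colon_corner:
  assumes "finite A" "finite B" "a \<in> A" "b \<in> B" "a' \<notin> A" "Suc m \<le> card A" "Suc m < card B"
  obtains D D' n where "D \<in> gens M m A B" "D' \<in> gens M (Suc m) (insert a' A) B"
    "\<And>h. D' * D ^ n * h \<in> idl (gens M (Suc m) A B) \<Longrightarrow> h \<in> idl (gens M (Suc m) A B)"
    "\<And>F. F \<in> gens M (Suc m) A B \<Longrightarrow> D' * D ^ n * F \<in> idl (gens M (Suc m) A (B - {b}) \<union>
      gens M (Suc m) (A - {a}) B \<union> gens M (Suc (Suc m)) (insert a' A) B)"
proof -
  let ?S = "gens M (Suc m) A (B - {b}) \<union> gens M (Suc m) (A - {a}) B \<union> gens M (Suc (Suc m)) (insert a' A) B"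
  obtain f where f: "inj f" "f ` {..<card (A - {a})} = A - {a}"
    using ex_inj_enumeration[of "A - {a}"] assms(1) by blast
  obtain g where g: "inj g" "g ` {..<card (B - {b})} = B - {b}"
    using ex_inj_enumeration[of "B - {b}"] assms(2) by blast
  have fA: "f ` {..<m} \<subseteq> A - {a}"
  proof -
    have "f ` {..<m} \<subseteq> f ` {..<card (A - {a})}" using assms by (intro image_mono) auto
    then show ?thesis using f(2) by simp
  qed
  have gB: "g ` {..<Suc m} \<subseteq> B - {b}"
  proof -
    have "g ` {..<Suc m} \<subseteq> g ` {..<card (B - {b})}" using assms by (intro image_mono) auto
    then show ?thesis using g(2) by simp
  qed
  let ?D = "minor M m f g"
  define Bo where "Bo i j = minor M (Suc m) (f(m := i)) (g(m := j))" for i j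
  define f' where "f' = f(m := a')"
  define D' where "D' = minor M (Suc m) f' g"
  have f'A: "f' ` {..<Suc m} \<subseteq> insert a' A"
    unfolding f'_def image_upd_lessThan_Suc using fA by blast
  have border: "Bo i j \<in> idl (insert (Bo a b) ?S)" if "i \<in> A" "j \<in> B" for i j
  proof (cases "i = a \<and> j = b")
    case False
    have "Bo i j \<in> gens M (Suc m) A (B - {b})" if "j \<noteq> b"
      unfolding Bo_def
    proof (rule minor_in_gens; unfold image_upd_lessThan_Suc)
      have "g ` {..<m} \<subseteq> g ` {..<Suc m}" by (intro image_mono) auto
      then show "insert j (g ` {..<m}) \<subseteq> B - {b}" using gB that \<open>j \<in> B\<close> by blast
      show "insert i (f ` {..<m}) \<subseteq> A" using fA that \<open>i \<in> A\<close> by blast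
    qed
    moreover have "Bo i j \<in> gens M (Suc m) (A - {a}) B" if "i \<noteq> a"
      unfolding Bo_def
    proof (rule minor_in_gens; unfold image_upd_lessThan_Suc)
      have "g ` {..<m} \<subseteq> g ` {..<Suc m}" by (intro image_mono) auto
      then show "insert j (g ` {..<m}) \<subseteq> B" using gB that \<open>j \<in> B\<close> by blast
      show "insert i (f ` {..<m}) \<subseteq> A - {a}" using fA that \<open>i \<in> A\<close> by blast
    qed
    ultimately show ?thesis using False by (intro idl.span_base) auto
  qed (simp add: idl.span_base)
  have corner: "D' * Bo a b \<in> idl ?S"
  proof -
    define K where "K e = border_cof (\<lambda>i j. M j i) m g f e a" for e
    define H where "H c = border_cof M (Suc m) f' g c b" for c
    have Bo_col: "Bo a j = M a j * ?D + (\<Sum>e<m. M (f e) j * K e)" for j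
      using minor_border[of "\<lambda>i j. M j i" m g j f a]
      unfolding Bo_def K_def minor_transpose[of M] .
    \<comment> \<open>For \<open>i\<close> among the rows of \<open>D'\<close> this minor has a
      repeated row; it still counts as a generator.\<close>
    have rel: "M i b * D' + (\<Sum>c<Suc m. M i (g c) * H c) \<in> idl ?S" if "i \<in> insert a' A" for i
    proof -
      have "minor M (Suc (Suc m)) (f'(Suc m := i)) (g(Suc m := b)) \<in> gens M (Suc (Suc m)) (insert a' A) B"
        by (rule minor_in_gens; unfold image_upd_lessThan_Suc) (use f'A gB that assms in blast)+
      then show ?thesis
        unfolding minor_border D'_def H_def by (intro idl.span_base) auto
    qed
    have BoS: "Bo a (g c) \<in> idl ?S" if "c < Suc m" for c
    proof -
      have "g c \<in> g ` {..<Suc m}" "g ` {..<m} \<subseteq> g ` {..<Suc m}" using that by auto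
      then have "Bo a (g c) \<in> gens M (Suc m) A (B - {b})"
        unfolding Bo_def
        by (intro minor_in_gens; unfold image_upd_lessThan_Suc) (use fA gB assms in blast)+
      then show ?thesis by (intro idl.span_base) blast
    qed
    have "D' * Bo a b =
        ?D * (M a b * D' + (\<Sum>c<Suc m. M a (g c) * H c)) +
        (\<Sum>e<m. K e * (M (f e) b * D' + (\<Sum>c<Suc m. M (f e) (g c) * H c)))
        - (\<Sum>c<Suc m. H c * Bo a (g c))"
    proof -
      have "(\<Sum>e<m. K e * (\<Sum>c<Suc m. M (f e) (g c) * H c)) = (\<Sum>c<Suc m. H c * (\<Sum>e<m. M (f e) (g c) * K e))"
        unfolding sum_distrib_left by (subst sum.swap) (simp only: mult_ac)
      then show ?thesis
        unfolding Bo_col distrib_left sum.distrib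
        by (simp add: sum_distrib_left mult_ac del: sum.lessThan_Suc)
    qed
    also have "\<dots> \<in> idl ?S"
    proof (rule idl.span_diff[OF idl.span_add])
      show "?D * (M a b * D' + (\<Sum>c<Suc m. M a (g c) * H c)) \<in> idl ?S"
        by (intro idl.span_scale rel) (use assms in auto)
      show "(\<Sum>e<m. K e * (M (f e) b * D' + (\<Sum>c<Suc m. M (f e) (g c) * H c))) \<in> idl ?S"
        by (intro idl.span_sum idl.span_scale rel) (use fA in auto)
      show "(\<Sum>c<Suc m. H c * Bo a (g c)) \<in> idl ?S"
        by (intro idl.span_sum idl.span_scale BoS) auto
    qed
    finally show ?thesis .
  qed
  have absorb: "D' * z \<in> idl ?S" if "z \<in> idl (insert (Bo a b) ?S)" for z
  proof -
    have "idl (insert (Bo a b) ?S) \<subseteq> {z. D' * z \<in> idl ?S}"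
    proof (rule idl.span_minimal)
      show "insert (Bo a b) ?S \<subseteq> {z. D' * z \<in> idl ?S}"
        using corner idl.span_scale[OF idl.span_base, of _ ?S D'] by blast
      show "idl.subspace {z. D' * z \<in> idl ?S}"
        by (rule idl.subspaceI)
          (auto simp: idl.span_zero distrib_left idl.span_add mult.left_commute[of D'] idl.span_scale)
    qed
    then show ?thesis using that by blast
  qed
  show ?thesis
  proof (rule that[of ?D D' "Suc m"])
    have "g ` {..<m} \<subseteq> g ` {..<Suc m}" by (intro image_mono) auto
    then show "?D \<in> gens M m A B" using fA gB by (intro minor_in_gens) blast+
    show "D' \<in> gens M (Suc m) (insert a' A) B"
      unfolding D'_def using f'A gB by (intro minor_in_gens) auto
    show "D' * ?D ^ Suc m * F \<in> idl ?S" if "F \<in> gens M (Suc m) A B" for F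
      unfolding mult.assoc by (rule absorb, rule pivot_mult_minor[OF border[unfolded Bo_def] that, folded Bo_def])
    have prime: "prime_like (idl (gens M (Suc m) A B))"
      by (rule prime_gens) (use assms in auto)
    have "card {u. u < m \<and> f u \<in> A \<and> g u \<in> B} \<le> card {..<m}" by (intro card_mono) auto
    then have D: "?D \<notin> idl (gens M (Suc m) A B)"
      by (intro minor_notin_gens inj_on_subset[OF f(1)] inj_on_subset[OF g(1)]) auto
    have "{u. u < Suc m \<and> f' u \<in> A \<and> g u \<in> B} \<subseteq> {..<m}"
      using assms(5) by (auto simp: f'_def less_Suc_eq)
    then have "card {u. u < Suc m \<and> f' u \<in> A \<and> g u \<in> B} \<le> card {..<m}" by (intro card_mono) auto
    moreover have "inj_on f' {..<Suc m}"
      unfolding f'_def using fA assms(5) by (intro inj_on_upd_lessThan_Suc inj_on_subset[OF f(1)]) auto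
    ultimately have D': "D' \<notin> idl (gens M (Suc m) A B)"
      unfolding D'_def by (intro minor_notin_gens inj_on_subset[OF g(1)]) auto
    show "h \<in> idl (gens M (Suc m) A B)" if "D' * ?D ^ Suc m * h \<in> idl (gens M (Suc m) A B)" for h
    proof -
      have "D' * (?D ^ Suc m * h) \<in> idl (gens M (Suc m) A B)" using that by (simp only: mult.assoc)
      then have "?D ^ Suc m * h \<in> idl (gens M (Suc m) A B)" using prime_likeD[OF prime] D' by blast
      then show ?thesis by (rule prime_like_power_mult[OF prime _ D])
    qed
  qed
qed

end

subsection \<open>The carrier ring\<close>

lemma carrier_polynomial_ring:
  "p \<in> carrier (polynomial_ring V) \<longleftrightarrow> (\<forall>m\<in>Poly_Mapping.keys p. Poly_Mapping.keys m \<subseteq> V)"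
  by (simp add: polynomial_ring_def)

lemma polynomial_ring_simps [simp]:
  "x \<otimes>\<^bsub>polynomial_ring V\<^esub> y = x * y" "x \<oplus>\<^bsub>polynomial_ring V\<^esub> y = x + y"
  "\<one>\<^bsub>polynomial_ring V\<^esub> = 1" "\<zero>\<^bsub>polynomial_ring V\<^esub> = 0"
  by (simp_all add: polynomial_ring_def)

lemma polynomial_ring_closed:
  shows polynomial_ring_0: "0 \<in> carrier (polynomial_ring V)"
    and polynomial_ring_1: "1 \<in> carrier (polynomial_ring V)"
    and polynomial_ring_const: "Poly_Mapping.single 0 c \<in> carrier (polynomial_ring V)"
    and polynomial_ring_indet: "x \<in> V \<Longrightarrow> indet x \<in> carrier (polynomial_ring V)"
    and polynomial_ring_uminus: "p \<in> carrier (polynomial_ring V) \<Longrightarrow> - p \<in> carrier (polynomial_ring V)"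
  by (auto simp: carrier_polynomial_ring indet_def in_keys_iff split: if_splits)

lemma polynomial_ring_add:
  assumes "p \<in> carrier (polynomial_ring V)" "q \<in> carrier (polynomial_ring V)"
  shows "p + q \<in> carrier (polynomial_ring V)"
  using assms Poly_Mapping.keys_add[of p q] by (auto simp: carrier_polynomial_ring)

lemma polynomial_ring_mult:
  assumes "p \<in> carrier (polynomial_ring V)" "q \<in> carrier (polynomial_ring V)"
  shows "p * q \<in> carrier (polynomial_ring V)"
  unfolding carrier_polynomial_ring
proof
  fix m assume "m \<in> Poly_Mapping.keys (p * q)"
  then obtain a b where m: "m = a + b" and ab: "a \<in> Poly_Mapping.keys p" "b \<in> Poly_Mapping.keys q"
    using keys_mult[of p q] by auto
  have "Poly_Mapping.keys a \<subseteq> V" "Poly_Mapping.keys b \<subseteq> V"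
    using ab assms by (auto simp: carrier_polynomial_ring)
  then show "Poly_Mapping.keys m \<subseteq> V"
    using Poly_Mapping.keys_add[of a b] unfolding m by blast
qed

lemma polynomial_ring_power:
  "p \<in> carrier (polynomial_ring V) \<Longrightarrow> p ^ n \<in> carrier (polynomial_ring V)"
  by (induction n) (auto intro: polynomial_ring_1 polynomial_ring_mult)

lemma polynomial_ring_prod:
  "(\<And>i. i \<in> A \<Longrightarrow> u i \<in> carrier (polynomial_ring V)) \<Longrightarrow> prod u A \<in> carrier (polynomial_ring V)"
  by (induction A rule: infinite_finite_induct) (auto intro: polynomial_ring_1 polynomial_ring_mult)

lemma polynomial_ring_sum:
  "(\<And>i. i \<in> A \<Longrightarrow> u i \<in> carrier (polynomial_ring V)) \<Longrightarrow> sum u A \<in> carrier (polynomial_ring V)"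
  by (induction A rule: infinite_finite_induct) (auto intro: polynomial_ring_0 polynomial_ring_add)

lemma polynomial_ring_minor:
  assumes "\<And>a b. a < t \<Longrightarrow> b < t \<Longrightarrow> M (f a) (g b) \<in> carrier (polynomial_ring V)"
  shows "minor M t f g \<in> carrier (polynomial_ring V)"
  by (rule minor_closed)
    (auto intro: assms polynomial_ring_add polynomial_ring_mult polynomial_ring_0 polynomial_ring_1
      polynomial_ring_uminus)

lemma cring_polynomial_ring: "cring (polynomial_ring V :: ('x, 'a::comm_ring_1) mpoly ring)"
proof (rule cringI)
  show "abelian_group (polynomial_ring V :: ('x, 'a) mpoly ring)"
    by (rule abelian_groupI)
      (auto intro: polynomial_ring_add polynomial_ring_0 polynomial_ring_uminus bexI[of _ "- _"] simp: ac_simps)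
  show "comm_monoid (polynomial_ring V :: ('x, 'a) mpoly ring)"
    by (rule comm_monoidI) (auto intro: polynomial_ring_mult polynomial_ring_1 simp: ac_simps)
qed (auto simp: algebra_simps)

lemma retraction_polynomial_ring:
  obtains \<pi> :: "('x, 'a::comm_ring_1) mpoly \<Rightarrow> ('x, 'a) mpoly"
  where "comm_ring_hom \<pi>" "\<And>z. \<pi> z \<in> carrier (polynomial_ring V)"
    "\<And>z. z \<in> carrier (polynomial_ring V) \<Longrightarrow> \<pi> z = z"
proof
  let ?v = "\<lambda>x. if x \<in> V then indet x else 0 :: ('x, 'a) mpoly"
  let ?p = "meval (Poly_Mapping.single 0) ?v"
  show "comm_ring_hom ?p"
    by (rule comm_ring_hom.comm_ring_hom_meval[OF comm_ring_hom_single])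
  show "?p z \<in> carrier (polynomial_ring V)" for z
    unfolding meval_def mon_eval_def
    by (intro polynomial_ring_sum polynomial_ring_mult polynomial_ring_const polynomial_ring_prod polynomial_ring_power)
      (auto intro: polynomial_ring_indet polynomial_ring_0)
  show "?p z = z" if "z \<in> carrier (polynomial_ring V)" for z
  proof -
    have "?p z = meval (Poly_Mapping.single 0) indet z"
      by (rule meval_cong) (use that in \<open>auto simp: carrier_polynomial_ring\<close>)
    then show ?thesis by (simp add: meval_single_indet)
  qed
qed

lemma uminus_polynomial_ring:
  assumes "x \<in> carrier (polynomial_ring V)"
  shows "\<ominus>\<^bsub>polynomial_ring V\<^esub> x = - x"
proof -
  interpret cring "polynomial_ring V" by (rule cring_polynomial_ring)
  show ?thesis
    by (rule minus_equality) (use assms in \<open>auto intro: polynomial_ring_uminus\<close>)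
qed

text \<open>The retraction sending the indeterminates outside \<open>V\<close> to 0 turns a
  combination with arbitrary coefficients into one with coefficients in the carrier, and it fixes
  \<open>S\<close> and the element.\<close>

lemma genideal_polynomial_ring:
  fixes S :: "('x, 'a::comm_ring_1) mpoly set"
  assumes "S \<subseteq> carrier (polynomial_ring V)"
  shows "Idl\<^bsub>polynomial_ring V\<^esub> S = idl S \<inter> carrier (polynomial_ring V)"
proof -
  let ?R = "polynomial_ring V :: ('x, 'a) mpoly ring"
  interpret cring ?R by (rule cring_polynomial_ring)
  have "ideal (idl S \<inter> carrier ?R) ?R"
  proof (rule idealI)
    show "subgroup (idl S \<inter> carrier ?R) (add_monoid ?R)"
    proof (rule subgroup.intro)
      fix x assume "x \<in> idl S \<inter> carrier ?R"
      then show "inv\<^bsub>add_monoid ?R\<^esub> x \<in> idl S \<inter> carrier ?R"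
        using uminus_polynomial_ring[of x V] unfolding a_inv_def
        by (auto intro: polynomial_ring_uminus idl.span_neg)
    qed (auto intro: idl.span_add idl.span_zero polynomial_ring_add polynomial_ring_0)
  qed (auto intro: ring_axioms idl.span_scale idl_mult_right polynomial_ring_mult)
  then have "Idl\<^bsub>?R\<^esub> S \<subseteq> idl S \<inter> carrier ?R"
    by (rule genideal_minimal) (use assms idl.span_superset[of S] in auto)
  moreover have "z \<in> Idl\<^bsub>?R\<^esub> S" if z: "z \<in> idl S" "z \<in> carrier ?R" for z
  proof -
    obtain \<pi> :: "('x, 'a) mpoly \<Rightarrow> ('x, 'a) mpoly" where \<pi>: "comm_ring_hom \<pi>"
      "\<And>z. \<pi> z \<in> carrier ?R" "\<And>z. z \<in> carrier ?R \<Longrightarrow> \<pi> z = z"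
      using retraction_polynomial_ring[of V, where 'a = 'a] by blast
    interpret \<pi>: comm_ring_hom \<pi> by fact
    interpret I: ideal "Idl\<^bsub>?R\<^esub> S" ?R by (rule genideal_ideal[OF assms])
    have "idl S \<subseteq> {z. \<pi> z \<in> Idl\<^bsub>?R\<^esub> S}"
    proof (rule idl.span_minimal)
      show "S \<subseteq> {z. \<pi> z \<in> Idl\<^bsub>?R\<^esub> S}"
        using genideal_self[OF assms] assms \<pi>(3) by auto
      show "idl.subspace {z. \<pi> z \<in> Idl\<^bsub>?R\<^esub> S}"
      proof (rule idl.subspaceI)
        show "0 \<in> {z. \<pi> z \<in> Idl\<^bsub>?R\<^esub> S}" using I.zero_closed by (simp add: \<pi>.hom_zero)
        show "x + y \<in> {z. \<pi> z \<in> Idl\<^bsub>?R\<^esub> S}"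
          if "x \<in> {z. \<pi> z \<in> Idl\<^bsub>?R\<^esub> S}" "y \<in> {z. \<pi> z \<in> Idl\<^bsub>?R\<^esub> S}" for x y
          using I.a_closed[of "\<pi> x" "\<pi> y"] that by (simp add: \<pi>.hom_add)
        show "c * x \<in> {z. \<pi> z \<in> Idl\<^bsub>?R\<^esub> S}" if "x \<in> {z. \<pi> z \<in> Idl\<^bsub>?R\<^esub> S}" for c x
          using I.I_l_closed[of "\<pi> x" "\<pi> c"] that \<pi>(2) by (simp add: \<pi>.hom_mult)
      qed
    qed
    then show ?thesis using z \<pi>(3) by auto
  qed
  ultimately show ?thesis by blast
qed

subsection \<open>Knutson ideals by generators\<close>

locale knutson =
  fixes V :: "'x set" and R :: "('x, 'a::comm_ring_1) mpoly ring" and f :: "('x, 'a) mpoly"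
  assumes R: "R = polynomial_ring V" and f: "f \<in> carrier R"
begin

text \<open>The span is taken in the full polynomial ring, where no carrier conditions are needed, and cut
  down to \<open>R\<close> only at the end.\<close>

definition knutson_gen :: "('x, 'a) mpoly set \<Rightarrow> bool" where
  "knutson_gen S \<longleftrightarrow> S \<subseteq> carrier R \<and> idl S \<inter> carrier R \<in> knutson_ideals R f"

sublocale cring R
  unfolding R by (rule cring_polynomial_ring)

lemma genideal_eq: "S \<subseteq> carrier R \<Longrightarrow> Idl\<^bsub>R\<^esub> S = idl S \<inter> carrier R"
  unfolding R by (rule genideal_polynomial_ring)

lemma knutson_gen_cong:
  assumes "knutson_gen S" "T \<subseteq> carrier R" "idl S = idl T"
  shows "knutson_gen T"
  using assms by (simp add: knutson_gen_def)

lemma knutson_gen_f: "knutson_gen {f}"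
  using knutson_ideals.principal[of R f] genideal_eq[of "{f}"] f
  by (simp add: knutson_gen_def cgenideal_eq_genideal)

lemma knutson_gen_Un:
  assumes "knutson_gen S" "knutson_gen T"
  shows "knutson_gen (S \<union> T)"
proof -
  let ?S = "idl S \<inter> carrier R" and ?T = "idl T \<inter> carrier R"
  have ST: "S \<subseteq> carrier R" "T \<subseteq> carrier R" using assms by (auto simp: knutson_gen_def)
  have ideals: "ideal ?S R" "ideal ?T R"
    using genideal_ideal[OF ST(1)] genideal_ideal[OF ST(2)] genideal_eq ST by simp_all
  have "?S <+>\<^bsub>R\<^esub> ?T = Idl\<^bsub>R\<^esub> (?S \<union> ?T)"
    by (rule union_genideal[OF ideals, symmetric])
  also have "\<dots> = idl (?S \<union> ?T) \<inter> carrier R"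
    by (rule genideal_eq) auto
  also have "idl (?S \<union> ?T) = idl (S \<union> T)"
  proof (rule idl_eqI)
    show "?S \<union> ?T \<subseteq> idl (S \<union> T)"
      using idl.span_mono[of S "S \<union> T"] idl.span_mono[of T "S \<union> T"] by blast
    have "S \<union> T \<subseteq> ?S \<union> ?T" using ST idl.span_superset by blast
    then show "S \<union> T \<subseteq> idl (?S \<union> ?T)" using idl.span_superset by blast
  qed
  finally have "?S <+>\<^bsub>R\<^esub> ?T = idl (S \<union> T) \<inter> carrier R" .
  moreover have "?S <+>\<^bsub>R\<^esub> ?T \<in> knutson_ideals R f"
    by (rule knutson_ideals.sum) (use assms in \<open>auto simp: knutson_gen_def\<close>)
  ultimately show ?thesis using ST by (simp add: knutson_gen_def)
qed

text \<open>The two inclusions of \<open>S : g = T\<close>. Condition \<open>up\<close> is asked in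
  the full polynomial ring, where primality provides it.\<close>

lemma knutson_gen_colon:
  assumes S: "knutson_gen S" and T: "T \<subseteq> carrier R" and g: "g \<in> carrier R"
    and down: "\<And>F. F \<in> T \<Longrightarrow> g * F \<in> idl S" and up: "\<And>h. g * h \<in> idl S \<Longrightarrow> h \<in> idl T"
  shows "knutson_gen T"
proof -
  have mult: "x \<otimes>\<^bsub>R\<^esub> y = x * y" for x y unfolding R by simp
  have "idl T \<subseteq> {z. g * z \<in> idl S}"
    by (rule idl.span_minimal)
      (use down in \<open>auto intro!: idl.subspaceI simp: idl.span_zero distrib_left idl.span_add mult.left_commute[of g] idl.span_scale\<close>)
  then have gT: "g * h \<in> idl S" if "h \<in> idl T" for h using that by blast
  have "ideal_quotient R (idl S \<inter> carrier R) (PIdl\<^bsub>R\<^esub> g) = idl T \<inter> carrier R"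
  proof (intro equalityI subsetI)
    fix h assume h: "h \<in> ideal_quotient R (idl S \<inter> carrier R) (PIdl\<^bsub>R\<^esub> g)"
    have "g \<in> PIdl\<^bsub>R\<^esub> g" using cgenideal_self[OF g] .
    then have "h * g \<in> idl S" using h by (auto simp: ideal_quotient_def mult)
    then show "h \<in> idl T \<inter> carrier R"
      using up[of h] h by (simp add: ideal_quotient_def mult.commute)
  next
    fix h assume h: "h \<in> idl T \<inter> carrier R"
    have "h \<otimes>\<^bsub>R\<^esub> x \<in> idl S \<inter> carrier R" if x: "x \<in> PIdl\<^bsub>R\<^esub> g" for x
    proof -
      obtain a where a: "a \<in> carrier R" "x = a * g" using x by (auto simp: cgenideal_def mult)
      then have "h \<otimes>\<^bsub>R\<^esub> x = a * (g * h)" by (simp add: mult mult_ac)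
      then have "h \<otimes>\<^bsub>R\<^esub> x \<in> idl S" using gT[of h] h by (auto intro: idl.span_scale)
      moreover have "h \<otimes>\<^bsub>R\<^esub> x \<in> carrier R" using h a g m_closed[of a g] m_closed[of h "a * g"] by (simp add: mult)
      ultimately show ?thesis by blast
    qed
    then show "h \<in> ideal_quotient R (idl S \<inter> carrier R) (PIdl\<^bsub>R\<^esub> g)"
      using h by (simp add: ideal_quotient_def)
  qed
  moreover have "ideal_quotient R (idl S \<inter> carrier R) (PIdl\<^bsub>R\<^esub> g) \<in> knutson_ideals R f"
    by (rule knutson_ideals.quotient) (use S g in \<open>auto simp: knutson_gen_def intro: cgenideal_ideal\<close>)
  ultimately show ?thesis using T by (simp add: knutson_gen_def)
qed

end

lemma idl_singleton: "idl {a} = range (\<lambda>c. c * a)"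
  using idl.span_singleton[of a] by simp

text \<open>\<open>(f) : q = (p)\<close>, which brings in the single factors of
  \<open>f\<close>.\<close>

lemma (in knutson) knutson_gen_factor:
  fixes p q :: "('x, 'a) mpoly"
  assumes "f = p * q" "p \<in> carrier R" "q \<in> carrier R" "\<And>a b. q * a = q * b \<Longrightarrow> a = b"
  shows "knutson_gen {p}"
proof (rule knutson_gen_colon[OF knutson_gen_f])
  show "h \<in> idl {p}" if "q * h \<in> idl {f}" for h
  proof -
    obtain c where "q * h = c * f" using \<open>q * h \<in> idl {f}\<close> by (auto simp: idl_singleton)
    then have "q * h = q * (c * p)" unfolding assms(1) by (simp only: mult_ac)
    then show ?thesis using assms(4) by (auto simp: idl_singleton)
  qed
  show "q * F \<in> idl {f}" if "F \<in> {p}" for F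
    using that assms(1) by (simp add: idl.span_base mult.commute)
qed (use assms in auto)

subsection \<open>Minors of blocks\<close>

lemma pick_interval: "i < b - a \<Longrightarrow> pick {a..<b} i = a + i"
proof (induction i)
  case 0
  then show ?case by (auto intro!: Least_equality)
next
  case (Suc i)
  then have "pick {a..<b} i = a + i" by simp
  then show ?case
    using Suc.prems by (auto intro!: Least_equality)
qed

lemma block_eq_mat:
  assumes "b \<le> dim_col Y" "d \<le> dim_row Y"
  shows "block Y a b c d = mat (d - (c - 1)) (b - (a - 1)) (\<lambda>(i, j). Y $$ (c - 1 + i, a - 1 + j))"
proof -
  have "{i. i < dim_row Y \<and> i \<in> {c - 1..<d}} = {c - 1..<d}" "{j. j < dim_col Y \<and> j \<in> {a - 1..<b}} = {a - 1..<b}"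
    using assms by auto
  then show ?thesis
    unfolding block_def submatrix_def by (intro eq_matI) (auto simp: pick_interval)
qed

lemma block_generic_matrix:
  assumes "b \<le> l" "d \<le> k" "1 \<le> a" "1 \<le> c"
  shows "block (generic_matrix k l) a b c d = mat (d - (c - 1)) (b - (a - 1)) (\<lambda>(i, j). indet (c - 1 + i, a - 1 + j))"
  using assms by (subst block_eq_mat) (auto simp: generic_matrix_def intro!: eq_matI)

section \<open>Minors indexed by functions and by sets\<close>

lemma ex_permutation_of_enumeration:
  fixes f \<alpha> :: "nat \<Rightarrow> 'b"
  assumes "inj_on f {..<t}" "inj_on \<alpha> {..<t}" "f ` {..<t} = \<alpha> ` {..<t}"
  obtains p where "p permutes {0..<t}" "\<And>i. i < t \<Longrightarrow> f i = \<alpha> (p i)"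
proof -
  define p where "p i = (if i < t then inv_into {..<t} \<alpha> (f i) else i)" for i
  have mem: "f i \<in> \<alpha> ` {..<t}" if "i < t" for i using assms(3) that by blast
  have \<alpha>p: "\<alpha> (p i) = f i" "p i < t" if "i < t" for i
    using mem[OF that] f_inv_into_f[of "f i" \<alpha> "{..<t}"] inv_into_into[of "f i" \<alpha> "{..<t}"] that
    by (simp_all add: p_def)
  have inj: "inj_on p {..<t}"
  proof (rule inj_onI)
    fix i j assume "i \<in> {..<t}" "j \<in> {..<t}" "p i = p j"
    then have "f i = f j" using \<alpha>p(1)[of i] \<alpha>p(1)[of j] by simp
    then show "i = j" using inj_onD[OF assms(1)] \<open>i \<in> {..<t}\<close> \<open>j \<in> {..<t}\<close> by blast
  qed
  have "p ` {..<t} \<subseteq> {..<t}" using \<alpha>p(2) by auto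
  from endo_inj_surj[OF finite_lessThan this inj] inj have "bij_betw p {..<t} {..<t}"
    by (simp add: bij_betw_def)
  then have "p permutes {0..<t}"
    by (intro bij_imp_permutes) (auto simp: p_def lessThan_atLeast0)
  then show ?thesis using that \<alpha>p(1) by metis
qed

text \<open>Injective index functions with the same range differ by a permutation, hence their
  minors by a sign; a repeated index gives 0.\<close>

lemma minor_mem_idl_of_enumeration:
  assumes "inj_on \<alpha> {..<t}" "inj_on \<beta> {..<t}" "f ` {..<t} \<subseteq> \<alpha> ` {..<t}" "g ` {..<t} \<subseteq> \<beta> ` {..<t}"
  shows "minor M t f g \<in> idl {minor M t \<alpha> \<beta>}"
proof (cases "inj_on f {..<t} \<and> inj_on g {..<t}")
  case True
  have "f ` {..<t} = \<alpha> ` {..<t}"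
    by (rule card_subset_eq[OF _ assms(3)]) (use True assms(1) in \<open>simp_all add: card_image\<close>)
  moreover have "g ` {..<t} = \<beta> ` {..<t}"
    by (rule card_subset_eq[OF _ assms(4)]) (use True assms(2) in \<open>simp_all add: card_image\<close>)
  ultimately obtain p q where p: "p permutes {0..<t}" "\<And>i. i < t \<Longrightarrow> f i = \<alpha> (p i)"
    and q: "q permutes {0..<t}" "\<And>i. i < t \<Longrightarrow> g i = \<beta> (q i)"
    using ex_permutation_of_enumeration True assms(1,2) by metis
  have "minor M t f g = minor M t (\<alpha> \<circ> p) (\<beta> \<circ> q)"
    by (rule minor_cong) (simp add: p q)
  also have "\<dots> = signof p * (signof q * minor M t \<alpha> \<beta>)"
    by (simp add: minor_permute_row[OF p(1)] minor_permute_col[OF q(1)])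
  also have "\<dots> \<in> idl {minor M t \<alpha> \<beta>}"
    by (intro idl.span_scale idl.span_base) simp
  finally show ?thesis .
qed (auto simp: minor_not_inj_row minor_not_inj_col idl.span_zero)

lemma idl_gens_square:
  "idl {minor M t ((+) a) ((+) b)} = idl (gens M t {a..<a + t} {b..<b + t})"
proof (rule idl_eqI)
  have *: "(+) c ` {..<t} = {c..<c + t}" for c
    by (simp add: lessThan_atLeast0 add.commute)
  show "{minor M t ((+) a) ((+) b)} \<subseteq> idl (gens M t {a..<a + t} {b..<b + t})"
    using minor_in_gens[of "(+) a" t "{a..<a + t}" "(+) b" "{b..<b + t}" M] idl.span_base by (auto simp: *)
  show "gens M t {a..<a + t} {b..<b + t} \<subseteq> idl {minor M t ((+) a) ((+) b)}"
    by (auto elim!: gensE intro!: minor_mem_idl_of_enumeration simp: *)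
qed

lemma pick_enumerates:
  assumes "finite I" "card I = t"
  shows "inj_on (pick I) {..<t}" "pick I ` {..<t} = I"
proof -
  show inj: "inj_on (pick I) {..<t}"
    by (rule inj_onI) (metis assms(2) lessThan_iff nat_neq_iff pick_mono_le)
  show "pick I ` {..<t} = I"
    using assms inj by (intro card_subset_eq) (auto simp: card_image pick_in_set_le)
qed

lemma minors_mat:
  "minors t (mat r s (\<lambda>(i, j). M i j)) =
    {minor M t (pick I) (pick J) | I J. I \<subseteq> {..<r} \<and> J \<subseteq> {..<s} \<and> card I = t \<and> card J = t}"
proof -
  have "det (submatrix (mat r s (\<lambda>(i, j). M i j)) I J) = minor M t (pick I) (pick J)"
    if IJ: "I \<subseteq> {..<r}" "J \<subseteq> {..<s}" "card I = t" "card J = t" for I J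
  proof -
    have eq: "{i. i < r \<and> i \<in> I} = I" "{j. j < s \<and> j \<in> J} = J" using IJ by auto
    have "pick I i < r" "pick J i < s" if "i < t" for i
      using pick_in_set_le[of i I] pick_in_set_le[of i J] IJ that by auto
    then have "submatrix (mat r s (\<lambda>(i, j). M i j)) I J = mat t t (\<lambda>(i, j). M (pick I i) (pick J j))"
      unfolding submatrix_def by (intro eq_matI) (auto simp: eq IJ)
    then show ?thesis by (simp add: minor_def)
  qed
  then show ?thesis
    unfolding minors_def by (auto; metis)
qed

lemma minors_mat_subset_gens: "minors t (mat r s (\<lambda>(i, j). M i j)) \<subseteq> gens M t {..<r} {..<s}"
proof
  fix F assume "F \<in> minors t (mat r s (\<lambda>(i, j). M i j))"
  then obtain I J where F: "F = minor M t (pick I) (pick J)" "I \<subseteq> {..<r}" "J \<subseteq> {..<s}" "card I = t" "card J = t"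
    by (auto simp: minors_mat)
  then have "finite I" "finite J" by (auto intro: finite_subset)
  then show "F \<in> gens M t {..<r} {..<s}"
    unfolding F(1) using pick_enumerates(2)[of I t] pick_enumerates(2)[of J t] F by (intro minor_in_gens) auto
qed

lemma idl_minors_mat: "idl (minors t (mat r s (\<lambda>(i, j). M i j))) = idl (gens M t {..<r} {..<s})"
proof (rule idl_eqI)
  show "minors t (mat r s (\<lambda>(i, j). M i j)) \<subseteq> idl (gens M t {..<r} {..<s})"
    using minors_mat_subset_gens idl.span_superset by blast
  show "gens M t {..<r} {..<s} \<subseteq> idl (minors t (mat r s (\<lambda>(i, j). M i j)))"
  proof
    fix F assume "F \<in> gens M t {..<r} {..<s}"
    then obtain f g where F: "F = minor M t f g" and fg: "f ` {..<t} \<subseteq> {..<r}" "g ` {..<t} \<subseteq> {..<s}"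
      by (rule gensE)
    show "F \<in> idl (minors t (mat r s (\<lambda>(i, j). M i j)))"
    proof (cases "inj_on f {..<t} \<and> inj_on g {..<t}")
      case True
      let ?I = "f ` {..<t}" and ?J = "g ` {..<t}"
      have card: "card ?I = t" "card ?J = t" using True by (auto simp: card_image)
      have "F \<in> idl {minor M t (pick ?I) (pick ?J)}"
        unfolding F
        by (rule minor_mem_idl_of_enumeration) (use card in \<open>simp_all add: pick_enumerates\<close>)
      moreover have "minor M t (pick ?I) (pick ?J) \<in> minors t (mat r s (\<lambda>(i, j). M i j))"
        unfolding minors_mat using fg card by blast
      ultimately show ?thesis
        using idl.span_mono[of "{minor M t (pick ?I) (pick ?J)}"] by blast
    qed (auto simp: F minor_not_inj_row minor_not_inj_col idl.span_zero)
  qed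
qed

subsection \<open>Producing new determinantal ideals\<close>

lemma (in generic_entries) knutson_gen_corner:
  assumes K: "knutson V R f"
    and fin: "finite A" "finite B" and mem: "a \<in> A" "b \<in> B" "a' \<notin> A"
    and card: "Suc m \<le> card A" "Suc m < card B"
    and carr: "\<And>i j. i \<in> insert a' A \<Longrightarrow> j \<in> B \<Longrightarrow> M i j \<in> carrier R"
    and G1: "knutson.knutson_gen R f (gens M (Suc m) A (B - {b}))"
    and G2: "Suc m \<le> card (A - {a}) \<Longrightarrow> knutson.knutson_gen R f (gens M (Suc m) (A - {a}) B)"
    and G3: "knutson.knutson_gen R f (gens M (Suc (Suc m)) (insert a' A) B)"
  shows "knutson.knutson_gen R f (gens M (Suc m) A B)"
proof -
  interpret knutson V R f by fact
  have carr': "gens M t (insert a' A) B \<subseteq> carrier R" for t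
    using carr by (auto elim!: gensE simp: R image_subset_iff intro!: polynomial_ring_minor)
  let ?S1 = "gens M (Suc m) A (B - {b})" and ?S2 = "gens M (Suc m) (A - {a}) B"
    and ?S3 = "gens M (Suc (Suc m)) (insert a' A) B"
  let ?S = "?S1 \<union> ?S2 \<union> ?S3"
  obtain D D' n where D: "D \<in> gens M m A B" "D' \<in> gens M (Suc m) (insert a' A) B"
    "\<And>h. D' * D ^ n * h \<in> idl (gens M (Suc m) A B) \<Longrightarrow> h \<in> idl (gens M (Suc m) A B)"
    "\<And>F. F \<in> gens M (Suc m) A B \<Longrightarrow> D' * D ^ n * F \<in> idl ?S"
    using colon_corner[OF fin mem card] by metis
  have sub: "gens M t A B \<subseteq> carrier R" "gens M t (A - {a}) B \<subseteq> carrier R" "gens M t A (B - {b}) \<subseteq> carrier R" for t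
    using carr'[of t] gens_mono[of A "insert a' A" B B M t] gens_mono[of "A - {a}" "insert a' A" B B M t]
      gens_mono[of A "insert a' A" "B - {b}" B M t] by blast+
  have S: "knutson_gen ?S"
  proof (cases "Suc m \<le> card (A - {a})")
    case True
    then show ?thesis using G1 G2 G3 by (intro knutson_gen_Un) auto
  next
    case False
    \<comment> \<open>Here \<open>A\<close> has exactly \<open>m + 1\<close> rows. The second
      summand generates the zero ideal, which cannot enter the sum as a Knutson ideal for nonzero
      \<open>f\<close>, since all Knutson ideals contain \<open>f\<close>.\<close>
    then have "?S2 \<subseteq> {0}" using fin by (intro gens_subset_zero) auto
    then have S2: "?S2 \<subseteq> idl (?S1 \<union> ?S3)" by (rule idl_subset_zero)
    have "idl (?S1 \<union> ?S3) = idl ?S"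
    proof (rule idl_eqI)
      show "?S1 \<union> ?S3 \<subseteq> idl ?S" by (rule order.trans[OF _ idl.span_superset]) blast
      show "?S \<subseteq> idl (?S1 \<union> ?S3)"
        using idl.span_superset[of "?S1 \<union> ?S3"] S2 by (simp only: Un_subset_iff simp_thms)
    qed
    moreover have "?S \<subseteq> carrier R"
      using sub(2,3) carr' by (simp only: Un_subset_iff simp_thms)
    ultimately show ?thesis
      using knutson_gen_cong[OF knutson_gen_Un[OF G1 G3]] by (simp only:)
  qed
  \<comment> \<open>The (m+2)-minors through row \<open>a'\<close> expand along it, so the sum stays
    inside the target ideal, modulo which the colon element cancels.\<close>
  have "?S \<subseteq> idl (gens M (Suc m) A B)"
    using gens_insert_row[of M "Suc m" A B "gens M (Suc m) A B" a']
      idl.span_superset[of "gens M (Suc m) A B"]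
      gens_mono[of A A "B - {b}" B M "Suc m"] gens_mono[of "A - {a}" A B B M "Suc m"] by blast
  then have le: "idl ?S \<subseteq> idl (gens M (Suc m) A B)" by (rule idl_subsetI)
  show ?thesis
  proof (rule knutson_gen_colon[OF S sub(1)])
    show "D' * D ^ n \<in> carrier R"
      using D(1,2) sub(1) carr' unfolding R by (intro polynomial_ring_mult polynomial_ring_power) auto
    show "D' * D ^ n * h \<in> idl ?S \<Longrightarrow> h \<in> idl (gens M (Suc m) A B)" for h
      using le D(3) by blast
  qed (rule D(4))
qed

lemma (in generic_entries) knutson_gen_two_columns:
  assumes K: "knutson V R f"
    and fin: "finite A" "finite B" and "b1 \<noteq> b2" "m \<le> card A" "m \<le> card (B - {b1, b2})"
    and carr: "\<And>i j. i \<in> A \<Longrightarrow> j \<in> B \<Longrightarrow> M i j \<in> carrier R"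
    and G: "knutson.knutson_gen R f (gens M (Suc m) A (B - {b1}))"
      "knutson.knutson_gen R f (gens M (Suc m) A (B - {b2}))"
  shows "knutson.knutson_gen R f (gens M (Suc m) A B)"
proof -
  interpret knutson V R f by fact
  have carr': "gens M t A B \<subseteq> carrier R" for t
    using carr by (auto elim!: gensE simp: R image_subset_iff intro!: polynomial_ring_minor)
  let ?S = "gens M (Suc m) A (B - {b1}) \<union> gens M (Suc m) A (B - {b2})"
  obtain D n where D: "D \<in> gens M m A B"
    "\<And>h. D ^ n * h \<in> idl (gens M (Suc m) A B) \<Longrightarrow> h \<in> idl (gens M (Suc m) A B)"
    "\<And>F. F \<in> gens M (Suc m) A B \<Longrightarrow> D ^ n * F \<in> idl ?S"
    using colon_two_columns[OF assms(2-6)] by metis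
  have "?S \<subseteq> gens M (Suc m) A B"
    using gens_mono[of A A "B - {b1}" B M "Suc m"] gens_mono[of A A "B - {b2}" B M "Suc m"] by blast
  then have le: "idl ?S \<subseteq> idl (gens M (Suc m) A B)" by (rule idl.span_mono)
  show ?thesis
  proof (rule knutson_gen_colon[OF knutson_gen_Un[OF G] carr'])
    show "D ^ n \<in> carrier R"
      using D(1) carr' unfolding R by (intro polynomial_ring_power) auto
    show "D ^ n * h \<in> idl ?S \<Longrightarrow> h \<in> idl (gens M (Suc m) A B)" for h
      using le D(2) by blast
  qed (rule D(3))
qed

subsection \<open>The factors of the polynomial\<close>

abbreviation entry :: "nat \<Rightarrow> nat \<Rightarrow> (nat \<times> nat, 'a::field) mpoly" where
  "entry i j \<equiv> indet (i, j)"

interpretation generic_entries Pair entry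
  by standard auto

text \<open>Columns are added by adding rows to the transpose.\<close>

interpretation tr: generic_entries "\<lambda>i j. (j, i)" "\<lambda>i j. entry j i"
  by standard auto

locale knutson_matrix =
  fixes k l :: nat and R :: "(nat \<times> nat, 'a::field) mpoly ring" and f :: "(nat \<times> nat, 'a) mpoly"
  assumes kl: "1 \<le> k" "k \<le> l" and R_def: "R = generic_ring k l"
    and f_def: "f = knutson_poly k l (generic_matrix k l)"
begin

lemma entry_closed: "i < k \<Longrightarrow> j < l \<Longrightarrow> entry i j \<in> carrier R"
  unfolding R_def generic_ring_def by (rule polynomial_ring_indet) auto

lemma minor_entry_closed:
  "(\<And>i. i < t \<Longrightarrow> \<alpha> i < k) \<Longrightarrow> (\<And>i. i < t \<Longrightarrow> \<beta> i < l) \<Longrightarrow> minor entry t \<alpha> \<beta> \<in> carrier R"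
  using entry_closed unfolding R_def generic_ring_def by (intro polynomial_ring_minor) auto

lemma f_eq: "f = (\<Prod>j<k - 1. minor entry (Suc j) ((+) 0) ((+) 0) *
      minor entry (Suc j) ((+) (k - Suc j)) ((+) (l - Suc j))) *
    (\<Prod>j = 1..l - k + 1. minor entry k ((+) 0) ((+) (j - 1)))"
proof -
  have "det (block (generic_matrix k l) 1 (j + 1) 1 (j + 1)) = (minor entry (Suc j) ((+) 0) ((+) 0) :: (nat \<times> nat, 'a) mpoly)"
    "det (block (generic_matrix k l) (l - j) l (k - j) k) = (minor entry (Suc j) ((+) (k - Suc j)) ((+) (l - Suc j)) :: (nat \<times> nat, 'a) mpoly)"
    if "j \<in> {..<k - 1}" for j
  proof -
    have "k - (k - j - 1) = Suc j" "l - (l - j - 1) = Suc j" "j < l" using that kl by auto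
    then show "det (block (generic_matrix k l) 1 (j + 1) 1 (j + 1)) = (minor entry (Suc j) ((+) 0) ((+) 0) :: (nat \<times> nat, 'a) mpoly)"
      "det (block (generic_matrix k l) (l - j) l (k - j) k) = (minor entry (Suc j) ((+) (k - Suc j)) ((+) (l - Suc j)) :: (nat \<times> nat, 'a) mpoly)"
      using that kl by (simp_all add: block_generic_matrix minor_def)
  qed
  moreover have "det (block (generic_matrix k l) j (k + j - 1) 1 k) = (minor entry k ((+) 0) ((+) (j - 1)) :: (nat \<times> nat, 'a) mpoly)"
    if "j \<in> {1..l - k + 1}" for j
  proof -
    have "k + j - 1 - (j - 1) = k" "k + j - 1 \<le> l" using that kl by auto
    then show ?thesis using that by (simp add: block_generic_matrix minor_def)
  qed
  ultimately show ?thesis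
    unfolding f_def knutson_poly_def by (intro arg_cong2[where f = "(*)"] prod.cong) auto
qed

lemma f_nonzero: "f \<noteq> 0"
  unfolding f_eq by (simp add: minor_nonzero)

lemma factor_closed:
  shows corner_closed: "j < k - 1 \<Longrightarrow> minor entry (Suc j) ((+) 0) ((+) 0) \<in> carrier R"
    and corner_closed': "j < k - 1 \<Longrightarrow> minor entry (Suc j) ((+) (k - Suc j)) ((+) (l - Suc j)) \<in> carrier R"
    and window_closed: "j \<in> {1..l - k + 1} \<Longrightarrow> minor entry k ((+) 0) ((+) (j - 1)) \<in> carrier R"
  using kl by (auto intro!: minor_entry_closed)

lemma carrier_mult: "p \<in> carrier R \<Longrightarrow> q \<in> carrier R \<Longrightarrow> p * q \<in> carrier R"
  unfolding R_def generic_ring_def by (rule polynomial_ring_mult)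

lemma carrier_prod: "(\<And>i. i \<in> A \<Longrightarrow> u i \<in> carrier R) \<Longrightarrow> prod u A \<in> carrier R"
  unfolding R_def generic_ring_def by (rule polynomial_ring_prod)

lemma f_closed: "f \<in> carrier R"
  unfolding f_eq by (intro carrier_mult carrier_prod factor_closed) auto

sublocale knutson "{..<k} \<times> {..<l}" R f
  by standard (auto simp: R_def generic_ring_def f_closed[unfolded R_def generic_ring_def])

lemma knutson_gen_divisor:
  assumes f: "f = p * q" and "p \<in> carrier R" "q \<in> carrier R"
  shows "knutson_gen {p}"
proof (rule knutson_gen_factor[OF assms])
  have "q \<noteq> 0" using f f_nonzero by auto
  then show "q * a = q * b \<Longrightarrow> a = b" for a b by simp
qed

lemma knutson_gen_corner_factor:
  assumes "j < k - 1"
  shows "knutson_gen {minor entry (Suc j) ((+) 0) ((+) 0)}"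
    and "knutson_gen {minor entry (Suc j) ((+) (k - Suc j)) ((+) (l - Suc j))}"
proof -
  let ?P = "\<lambda>j. minor entry (Suc j) ((+) 0) ((+) 0) :: (nat \<times> nat, 'a) mpoly"
  let ?Q = "\<lambda>j. minor entry (Suc j) ((+) (k - Suc j)) ((+) (l - Suc j)) :: (nat \<times> nat, 'a) mpoly"
  let ?r = "(\<Prod>j\<in>{..<k - 1} - {j}. ?P j * ?Q j) * (\<Prod>j = 1..l - k + 1. minor entry k ((+) 0) ((+) (j - 1)))"
  have f: "f = ?P j * ?Q j * ?r"
    unfolding f_eq using assms by (subst prod.remove[of _ j]) (auto simp only: mult.assoc finite_lessThan lessThan_iff)
  have r: "?r \<in> carrier R"
    by (intro carrier_mult carrier_prod factor_closed) auto
  show "knutson_gen {?P j}"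
  proof (rule knutson_gen_divisor)
    show "f = ?P j * (?Q j * ?r)" using f by (simp only: mult.assoc)
  qed (intro carrier_mult factor_closed r assms)+
  show "knutson_gen {?Q j}"
  proof (rule knutson_gen_divisor)
    show "f = ?Q j * (?P j * ?r)" using f by (simp only: mult_ac)
  qed (intro carrier_mult factor_closed r assms)+
qed

lemma knutson_gen_window_factor:
  assumes "a + k \<le> l"
  shows "knutson_gen {minor entry k ((+) 0) ((+) a)}"
proof -
  let ?W = "\<lambda>j. minor entry k ((+) 0) ((+) (j - 1)) :: (nat \<times> nat, 'a) mpoly"
  let ?g = "\<Prod>j<k - 1. minor entry (Suc j) ((+) 0) ((+) 0) *
      minor entry (Suc j) ((+) (k - Suc j)) ((+) (l - Suc j)) :: (nat \<times> nat, 'a) mpoly"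
  let ?r = "?g * (\<Prod>j\<in>{1..l - k + 1} - {Suc a}. ?W j)"
  have a: "Suc a \<in> {1..l - k + 1}" using assms kl by auto
  have f: "f = ?W (Suc a) * ?r"
    unfolding f_eq using a by (subst prod.remove[of "{1..l - k + 1}" "Suc a"]) (auto simp only: mult_ac finite_atLeastAtMost)
  have "knutson_gen {?W (Suc a)}"
  proof (rule knutson_gen_divisor[OF f])
    show "?W (Suc a) \<in> carrier R" using a by (rule window_closed)
    show "?r \<in> carrier R" by (intro carrier_mult carrier_prod factor_closed) auto
  qed
  then show ?thesis by simp
qed

section \<open>Growing windows and rectangles\<close>

lemma gens_closed: "A \<subseteq> {..<k} \<Longrightarrow> B \<subseteq> {..<l} \<Longrightarrow> gens entry t A B \<subseteq> carrier R"
  by (auto elim!: gensE intro!: minor_entry_closed)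

lemma knutson_gen_square:
  assumes "knutson_gen {minor entry t ((+) a) ((+) b)}" "a + t \<le> k" "b + t \<le> l"
  shows "knutson_gen (gens entry t {a..<a + t} {b..<b + t})"
  by (rule knutson_gen_cong[OF assms(1) gens_closed idl_gens_square]) (use assms in auto)

text \<open>The two smaller windows have the same width and neighbouring offsets, so the induction
  on the width keeps the offset general.\<close>

lemma knutson_gen_window:
  assumes "k \<le> c" "a + c \<le> l"
  shows "knutson_gen (gens entry k {..<k} {a..<a + c})"
  using assms
proof (induction c arbitrary: a rule: dec_induct)
  case base
  then show ?case
    using knutson_gen_square[OF knutson_gen_window_factor[of a]] by (simp add: lessThan_atLeast0)
next
  case (step c)
  obtain m where m: "k = Suc m" using kl by (cases k) auto
  have B: "{a..<a + Suc c} - {a} = {Suc a..<Suc a + c}" "{a..<a + Suc c} - {a + c} = {a..<a + c}"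
    by auto
  have "knutson_gen (gens entry (Suc m) {..<k} {a..<a + Suc c})"
  proof (rule knutson_gen_two_columns[where ?b1.0 = a and ?b2.0 = "a + c"])
    show "knutson ({..<k} \<times> {..<l}) R f" by (rule knutson_axioms)
    \<comment> \<open>There remain \<open>c - 1\<close> columns, enough because
      \<open>k \<le> c\<close>.\<close>
    show "m \<le> card ({a..<a + Suc c} - {a, a + c})"
      using step m by (subst card_Diff_subset) auto
    show "knutson_gen (gens entry (Suc m) {..<k} ({a..<a + Suc c} - {a}))"
      unfolding B m[symmetric] using step.IH[of "Suc a"] step.prems by simp
    show "knutson_gen (gens entry (Suc m) {..<k} ({a..<a + Suc c} - {a + c}))"
      unfolding B m[symmetric] using step.IH[of a] step.prems by simp
  qed (use step m in \<open>auto intro: entry_closed\<close>)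
  then show ?case by (simp only: m)
qed

lemma knutson_gen_add_row:
  assumes "a \<in> A" "b \<in> B" "a' \<notin> A" "insert a' A \<subseteq> {..<k}" "B \<subseteq> {..<l}" "1 \<le> t" "t \<le> card A" "t < card B"
    and "knutson_gen (gens entry t A (B - {b}))"
    and "t \<le> card (A - {a}) \<Longrightarrow> knutson_gen (gens entry t (A - {a}) B)"
    and "knutson_gen (gens entry (Suc t) (insert a' A) B)"
  shows "knutson_gen (gens entry t A B)"
proof -
  obtain m where m: "t = Suc m" using assms by (cases t) auto
  have fin: "finite A" "finite B" using assms(4,5) by (auto intro: finite_subset)
  show ?thesis
    unfolding m
  proof (rule knutson_gen_corner[OF knutson_axioms fin assms(1-3)])
    show "Suc m \<le> card A" "Suc m < card B" using assms(7,8) m by simp_all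
    show "entry i j \<in> carrier R" if "i \<in> insert a' A" "j \<in> B" for i j
      using entry_closed that assms(4,5) by blast
    show "knutson_gen (gens entry (Suc m) (A - {a}) B)" if "Suc m \<le> card (A - {a})"
      using assms(10) that m by simp
  qed (use assms(9,11) m in simp_all)
qed

lemma knutson_gen_add_column:
  assumes "a \<in> A" "b \<in> B" "b' \<notin> B" "A \<subseteq> {..<k}" "insert b' B \<subseteq> {..<l}" "1 \<le> t" "t < card A" "t \<le> card B"
    and "knutson_gen (gens entry t (A - {a}) B)"
    and "t \<le> card (B - {b}) \<Longrightarrow> knutson_gen (gens entry t A (B - {b}))"
    and "knutson_gen (gens entry (Suc t) A (insert b' B))"
  shows "knutson_gen (gens entry t A B)"
proof -
  obtain m where m: "t = Suc m" using assms by (cases t) auto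
  have fin: "finite A" "finite B" using assms(4,5) by (auto intro: finite_subset)
  note tr = gens_transpose[of entry]
  have "knutson_gen (gens (\<lambda>i j. entry j i) (Suc m) B A)"
  proof (rule tr.knutson_gen_corner[OF knutson_axioms fin(2,1) assms(2,1,3)])
    show "Suc m \<le> card B" "Suc m < card A" using assms(7,8) m by simp_all
    show "entry j i \<in> carrier R" if "i \<in> insert b' B" "j \<in> A" for i j
      using entry_closed that assms(4,5) by blast
    show "knutson_gen (gens (\<lambda>i j. entry j i) (Suc m) (B - {b}) A)" if "Suc m \<le> card (B - {b})"
      unfolding tr using assms(10) that m by simp
  qed (use assms(9,11) m in \<open>simp_all add: tr\<close>)
  then show ?thesis unfolding tr m .
qed

text \<open>Northwest and southeast rectangles are linked through the whole matrix: without its last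
  column it is a northwest rectangle, without its first column a southeast one.\<close>

lemma knutson_gen_determinantal:
  assumes "1 \<le> t" "t \<le> r" "t \<le> s" "r \<le> k" "s \<le> l"
  shows "knutson_gen (gens entry t {..<r} {..<s}) \<and> knutson_gen (gens entry t {k - r..<k} {l - s..<l})"
  using assms
proof (induction "(r - t) + (s - t)" arbitrary: r s t rule: less_induct)
  case less
  note prems = less.prems
  have IH: "knutson_gen (gens entry t' {..<r'} {..<s'})" "knutson_gen (gens entry t' {k - r'..<k} {l - s'..<l})"
    if "(r' - t') + (s' - t') < (r - t) + (s - t)" "1 \<le> t'" "t' \<le> r'" "t' \<le> s'" "r' \<le> k" "s' \<le> l" for t' r' s'
    using less.hyps[OF that] by auto
  have nw: "{..<r} - {r - 1} = {..<r - 1}" "{..<s} - {s - 1} = {..<s - 1}"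
    "insert r {..<r} = {..<Suc r}" "insert s {..<s} = {..<Suc s}"
    using prems by auto
  have se: "{k - r..<k} - {k - r} = {k - (r - 1)..<k}" "{l - s..<l} - {l - s} = {l - (s - 1)..<l}"
    using prems by auto
  \<comment> \<open>When neither a row nor a column can be added, the rectangle is the square of
    size \<open>t\<close>, or has full height with \<open>t = k\<close>, or is the whole
    matrix.\<close>
  consider "t < s" "r < k" | "t < r" "s < l" | "r = t" "s = t" | "t = k" "r = k" | "r = k" "s = l" "t < k"
    using prems kl by linarith
  then show ?case
  proof cases
    case 1
    have se': "insert (k - Suc r) {k - r..<k} = {k - Suc r..<k}" using 1 by auto
    show ?thesis
    proof
      show "knutson_gen (gens entry t {..<r} {..<s})"
        by (rule knutson_gen_add_row[where a = "r - 1" and b = "s - 1" and a' = r]; (unfold nw)?; (rule IH(1))?)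
          (use 1 prems in auto)
      show "knutson_gen (gens entry t {k - r..<k} {l - s..<l})"
        by (rule knutson_gen_add_row[where a = "k - r" and b = "l - s" and a' = "k - Suc r"]; (unfold se se')?; (rule IH(2))?)
          (use 1 prems in auto)
    qed
  next
    case 2
    have se': "insert (l - Suc s) {l - s..<l} = {l - Suc s..<l}" using 2 by auto
    show ?thesis
    proof
      show "knutson_gen (gens entry t {..<r} {..<s})"
        by (rule knutson_gen_add_column[where a = "r - 1" and b = "s - 1" and b' = s]; (unfold nw)?; (rule IH(1))?)
          (use 2 prems in auto)
      show "knutson_gen (gens entry t {k - r..<k} {l - s..<l})"
        by (rule knutson_gen_add_column[where a = "k - r" and b = "l - s" and b' = "l - Suc s"]; (unfold se se')?; (rule IH(2))?)
          (use 2 prems in auto)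
    qed
  next
    case 3
    show ?thesis
    proof (cases "t < k")
      case True
      then have "t - 1 < k - 1" "Suc (t - 1) = t" using prems by auto
      then show ?thesis
        using knutson_gen_corner_factor[of "t - 1"] knutson_gen_square[of t 0 0]
          knutson_gen_square[of t "k - t" "l - t"] 3 prems by (simp add: lessThan_atLeast0)
    next
      case False
      then have "t = k" using 3 prems by simp
      then show ?thesis
        using knutson_gen_window[of k 0] knutson_gen_window[of k "l - k"] 3 prems kl
        by (simp add: lessThan_atLeast0)
    qed
  next
    case 4
    then show ?thesis
      using knutson_gen_window[of s 0] knutson_gen_window[of s "l - s"] prems by (simp add: lessThan_atLeast0)
  next
    case 5
    obtain m where m: "t = Suc m" using prems by (cases t) auto
    have "knutson_gen (gens entry (Suc m) {..<k} {..<l})"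
    proof (rule knutson_gen_two_columns[where ?b1.0 = "l - 1" and ?b2.0 = 0])
      show "knutson ({..<k} \<times> {..<l}) R f" by (rule knutson_axioms)
      show "l - 1 \<noteq> 0" "m \<le> card {..<k}" using 5 kl prems m by auto
      have "card ({..<l} - {l - 1, 0}) = l - 2"
        using 5 kl prems by (subst card_Diff_subset) auto
      then show "m \<le> card ({..<l} - {l - 1, 0})" using 5 kl m by simp
      have "{..<l} - {l - 1} = {..<l - 1}" "{..<l} - {0} = {l - (l - 1)..<l}" "{..<k} = {k - k..<k}"
        using 5 kl by auto
      then show "knutson_gen (gens entry (Suc m) {..<k} ({..<l} - {l - 1}))"
        "knutson_gen (gens entry (Suc m) {..<k} ({..<l} - {0}))"
        using IH[of k t "l - 1"] 5 kl prems m by auto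
    qed (auto intro: entry_closed)
    then show ?thesis using 5 m by (simp add: lessThan_atLeast0)
  qed
qed

end

theorem theorem5p3:
  fixes k l r s t :: nat
    and X :: "(nat \<times> nat, 'a::field) mpoly mat"
    and R :: "(nat \<times> nat, 'a) mpoly ring"
    and f :: "(nat \<times> nat, 'a) mpoly"
  assumes "k \<le> l"
    and "X = generic_matrix k l"
    and "R = generic_ring k l"
    and "f = knutson_poly k l X"
    and "1 \<le> r" and "r \<le> k"
    and "1 \<le> s" and "s \<le> l"
    and "1 \<le> t" and "t \<le> min r s"
  shows "minor_ideal R t (northwest X r s) \<in> knutson_ideals R f \<and>
         minor_ideal R t (southeast X r s) \<in> knutson_ideals R f"
proof -
  interpret knutson_matrix k l R f
    by standard (use assms in auto)
  \<comment> \<open>Both rectangles are translates of one \<open>r\<close> by \<open>s\<close>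
    block, so a single argument with offsets \<open>a\<close> and \<open>b\<close> passes from
    function-indexed minors to \<open>minor_ideal\<close>.\<close>
  have blocks: "minor_ideal R t (mat r s (\<lambda>(i, j). entry (a + i) (b + j))) \<in> knutson_ideals R f"
    if G: "knutson_gen (gens entry t {a..<a + r} {b..<b + s})" and ab: "a + r \<le> k" "b + s \<le> l" for a b
  proof -
    let ?N = "\<lambda>i j. entry (a + i) (b + j)"
    let ?m = "minors t (mat r s (\<lambda>(i, j). ?N i j)) :: (nat \<times> nat, 'a) mpoly set"
    have gens: "gens ?N t {..<r} {..<s} = gens entry t {a..<a + r} {b..<b + s}"
      using gens_reindex[of entry "(+) a" "(+) b" t "{..<r}" "{..<s}"]
      by (simp add: lessThan_atLeast0 add.commute)
    have "?m \<subseteq> gens entry t {a..<a + r} {b..<b + s}"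
      using minors_mat_subset_gens[of t r s ?N] unfolding gens .
    also have "\<dots> \<subseteq> carrier R" by (rule gens_closed) (use ab in auto)
    finally have sub: "?m \<subseteq> carrier R" .
    then have "minor_ideal R t (mat r s (\<lambda>(i, j). ?N i j)) = idl ?m \<inter> carrier R"
      unfolding minor_ideal_def by (rule genideal_eq)
    moreover have "knutson_gen ?m"
      by (rule knutson_gen_cong[OF G sub]) (simp only: idl_minors_mat gens)
    ultimately show ?thesis by (simp add: knutson_gen_def)
  qed
  have "northwest X r s = mat r s (\<lambda>(i, j). entry (0 + i) (0 + j))"
    unfolding northwest_def assms(2) using assms by (simp add: block_generic_matrix)
  moreover have "southeast X r s = mat r s (\<lambda>(i, j). entry (k - r + i) (l - s + j))"
    unfolding southeast_def assms(2) using assms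
    by (simp add: generic_matrix_def[of k l, THEN arg_cong[of _ _ dim_row]]
        generic_matrix_def[of k l, THEN arg_cong[of _ _ dim_col]] block_generic_matrix)
  ultimately show ?thesis
    using knutson_gen_determinantal[of t r s] assms blocks[of 0 0] blocks[of "k - r" "l - s"]
    by (simp add: lessThan_atLeast0)
qed

end
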